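(* Let $(\bar x,\bar u)\in\mathbb S^p_+\times\mathcal P$ be an optimal solution to the primal problem $$\min\ \tfrac12\langle x,\mathcal Qx\rangle+\langle c,x\rangle\quad\text{s.t.}\quad \mathcal Ax=b,\ x-u=0,\ x\in\mathbb S^p_+,\ u\in\mathcal P$$ with $\Lambda_P(\bar x,\bar u)\ne\emptyset$. Let $\mathcal W\subseteq\mathbb S^p$ be any linear subspace that contains $\mathrm{Range}\,\mathcal Q$. Then the following two conditions are equivalent: (i) The second-order sufficient optimality condition for the primal problem holds at $(\bar x,\bar u)$: $$\sup_{(s,y,z,v)\in\Lambda_P(\bar x,\bar u)}\big\{\langle\mathcal Qd_x,d_x\rangle+2\langle s,d_x\bar x^\dagger d_x\rangle\big\}>0,\quad\forall\,0\ne(d_x,d_u)\in\mathcal C(\bar x,\bar u).$$ (ii) The extended SRCQ for the dual problem holds at $\Lambda_P(\bar x,\bar u)$ with respect to $(\bar x,\bar u)$: $$\mathrm{conv}\Big\{\bigcup_{(s,y,z,v)\in\Lambda_P(\bar x,\bar u)}\big(T_{\mathbb S^p_+}(s)\cap\bar x^\perp+S_{\bar x,z}\big)\Big\}+\mathcal A^*\mathbb R^m-\mathcal Q\mathcal W=\mathbb S^p.$$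
   Context: $\mathbb S^p$: $p\times p$ real symmetric matrices with trace inner product; $\mathbb S^p_+$ the positive semi-definite cone, $\mathbb S^p_-=-\mathbb S^p_+$. $\mathcal Q:\mathbb S^p\to\mathbb S^p$ is self-adjoint positive semi-definite linear, $\mathcal A:\mathbb S^p\to\mathbb R^m$ linear, $c\in\mathbb S^p$, $b\in\mathbb R^m$, $\mathcal P\subset\mathbb S^p$ a nonempty convex polyhedral set. $T$, $N$: tangent and normal cones of convex analysis; $v^\perp=\{d:\langle d,v\rangle=0\}$; $\dagger$: Moore–Penrose pseudo-inverse; conv: convex hull; $\delta^*_{\mathcal P}$: support function of $\mathcal P$; $\theta(z):=\delta^*_{\mathcal P}(-z)$, $\theta'(z;u)$ its directional derivative. The dual problem is $\max\ \langle b,y\rangle-\frac12\langle w,\mathcal Qw\rangle-\delta^*_{\mathcal P}(-z)$ s.t. $s+\mathcal A^*y-\mathcal Qw+z=c$, $s\in\mathbb S^p_+$, $w\in\mathcal W$. $\Lambda_P(\bar x,\bar u)$ is the set of $(s,y,z,v)\in\mathbb S^p\times\mathbb R^m\times\mathbb S^p\times\mathbb S^p$ with $\mathcal Q\bar x+c-\mathcal A^*y-z-s=0$, $z+v=0$, $b-\mathcal A\bar x=0$, $\bar u-\bar x=0$, $s\in N_{\mathbb S^p_-}(-\bar x)$, $v\in N_{\mathcal P}(\bar u)$. Critical cone: $\mathcal C(\bar x,\bar u)=\{(d_x,d_u)\in\mathbb S^p\times\mathbb S^p:\mathcal Ad_x=0,\ d_u-d_x=0,\ d_x\in T_{\mathbb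 S^p_+}(\bar x),\ d_u\in T_{\mathcal P}(\bar u),\ \langle\mathcal Q\bar x+c,d_x\rangle=0\}$. $S_{x,z}:=\{u\in\mathbb S^p:\langle u,x\rangle+\theta'(z;u)=0\}$. *)

theory Defs
  imports "HOL-Analysis.Analysis"
begin

section \<open>The Euclidean space of real symmetric matrices\<close>

typedef 'p symmat = "{A :: real^'p^'p::finite. transpose A = A}"
  morphisms mat_of Symmat
  by (rule exI[of _ 0]) (simp add: transpose_def vec_eq_iff)

lemma transpose_mat_of [simp]: "transpose (mat_of X) = mat_of X"
  using mat_of[of X] by simp

lemma mat_of_nth_commute: "mat_of X $ i $ j = mat_of X $ j $ i"
  using arg_cong[OF transpose_mat_of[of X], of "\<lambda>M. M $ j $ i"] by (simp add: transpose_def)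

lemma symmat_eq_iff: "X = Y \<longleftrightarrow> mat_of X = mat_of Y"
  by (simp add: mat_of_inject)

instantiation symmat :: (finite) real_inner
begin

definition "0 = Symmat 0"
definition "X + Y = Symmat (mat_of X + mat_of Y)"
definition "- X = Symmat (- mat_of X)"
definition "X - Y = Symmat (mat_of X - mat_of Y)"
definition "r *\<^sub>R X = Symmat (r *\<^sub>R mat_of X)"
definition "X \<bullet> Y = trace (mat_of X ** mat_of Y)"
definition "norm (X :: 'a symmat) = sqrt (X \<bullet> X)"
definition "dist (X :: 'a symmat) Y = norm (X - Y)"
definition "sgn (X :: 'a symmat) = inverse (norm X) *\<^sub>R X"
definition "uniformity = (INF e\<in>{0<..}. principal {(X :: 'a symmat, Y). dist X Y < e})"
definition "open (U :: 'a symmat set) \<longleftrightarrow>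
  (\<forall>X\<in>U. eventually (\<lambda>(X', Y). X' = X \<longrightarrow> Y \<in> U) uniformity)"

lemma mat_of_zero [simp]: "mat_of 0 = 0"
  by (simp add: zero_symmat_def Symmat_inverse transpose_def vec_eq_iff)

lemma mat_of_add [simp]: "mat_of (X + Y) = mat_of X + mat_of Y"
  by (simp add: plus_symmat_def Symmat_inverse transpose_def vec_eq_iff mat_of_nth_commute)

lemma mat_of_uminus [simp]: "mat_of (- X) = - mat_of X"
  by (simp add: uminus_symmat_def Symmat_inverse transpose_def vec_eq_iff mat_of_nth_commute)

lemma mat_of_diff [simp]: "mat_of (X - Y) = mat_of X - mat_of Y"
  by (simp add: minus_symmat_def Symmat_inverse transpose_def vec_eq_iff mat_of_nth_commute)

lemma mat_of_scaleR [simp]: "mat_of (r *\<^sub>R X) = r *\<^sub>R mat_of X"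
  by (simp add: scaleR_symmat_def Symmat_inverse transpose_def vec_eq_iff mat_of_nth_commute)

lemma inner_symmat_eq: "X \<bullet> Y = mat_of X \<bullet> mat_of Y"
  by (simp add: inner_symmat_def trace_def matrix_matrix_mult_def inner_vec_def
      mat_of_nth_commute[of Y])

instance
proof
  fix X Y Z :: "'a symmat" and r s :: real
  show "X + Y + Z = X + (Y + Z)" "X + Y = Y + X" "0 + X = X" "- X + X = 0" "X - Y = X + - Y"
    by (simp_all add: symmat_eq_iff)
  show "r *\<^sub>R (X + Y) = r *\<^sub>R X + r *\<^sub>R Y" "(r + s) *\<^sub>R X = r *\<^sub>R X + s *\<^sub>R X"
    "r *\<^sub>R s *\<^sub>R X = (r * s) *\<^sub>R X" "1 *\<^sub>R X = X"
    by (simp_all add: symmat_eq_iff scaleR_right_distrib scaleR_left_distrib)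
  show "X \<bullet> Y = Y \<bullet> X"
    by (simp add: inner_symmat_eq inner_commute)
  show "(X + Y) \<bullet> Z = X \<bullet> Z + Y \<bullet> Z" "(r *\<^sub>R X) \<bullet> Y = r * (X \<bullet> Y)"
    "0 \<le> X \<bullet> X" "X \<bullet> X = 0 \<longleftrightarrow> X = 0"
    by (simp_all add: inner_symmat_eq inner_add_left symmat_eq_iff)
qed (simp_all add: norm_symmat_def dist_symmat_def sgn_symmat_def
    uniformity_symmat_def open_symmat_def)

end

lemma linear_mat_of: "linear mat_of"
  by (rule linearI) simp_all

text \<open>\<^const>\<open>Basis\<close> is an arbitrary orthonormal basis; nothing depends on the choice.\<close>

lemma symmat_orthonormal_basis_exists:
  "\<exists>B :: ('p::finite) symmat set. B \<noteq> {} \<and> finite B \<and>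
     (\<forall>u\<in>B. \<forall>v\<in>B. u \<bullet> v = (if u = v then 1 else 0)) \<and>
     (\<forall>x. (\<forall>u\<in>B. x \<bullet> u = 0) \<longleftrightarrow> x = 0)"
proof -
  let ?S = "range mat_of :: (real^'p^'p) set"
  have S: "subspace ?S"
    using linear_subspace_image[OF linear_mat_of subspace_UNIV] .
  obtain B where B: "B \<subseteq> ?S" "pairwise orthogonal B" "\<And>x. x \<in> B \<Longrightarrow> norm x = 1"
    "independent B" "span B = ?S"
    using orthonormal_basis_subspace[OF S] by metis
  have fin: "finite B"
    using B(4) independent_imp_finite by blast
  define C where "C = mat_of -` B"
  have img: "mat_of ` C = B"
    using B(1) by (auto simp: C_def)
  have fin': "finite C"
    unfolding C_def by (rule finite_vimageI[OF fin]) (simp add: inj_def mat_of_inject)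
  have orth: "u \<bullet> v = (if u = v then 1 else 0)" if "u \<in> C" "v \<in> C" for u v
  proof (cases "u = v")
    case True
    then show ?thesis
      using B(3)[of "mat_of u"] that by (simp add: C_def inner_symmat_eq norm_eq_1)
  next
    case False
    then have "orthogonal (mat_of u) (mat_of v)"
      using B(2) that by (auto simp: C_def pairwise_def symmat_eq_iff)
    with False show ?thesis
      by (simp add: inner_symmat_eq orthogonal_def)
  qed
  have zero: "x = 0" if "\<forall>u\<in>C. x \<bullet> u = 0" for x
  proof -
    have "\<And>b. b \<in> B \<Longrightarrow> orthogonal (mat_of x) b"
      using that img by (auto simp: inner_symmat_eq orthogonal_def)
    moreover have "mat_of x \<in> span B"
      using B(5) by simp
    ultimately have "orthogonal (mat_of x) (mat_of x)"
      by (metis orthogonal_to_span)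
    then show ?thesis
      by (simp add: orthogonal_def symmat_eq_iff)
  qed
  have nonempty: "C \<noteq> {}"
  proof
    assume "C = {}"
    then have "Symmat (mat 1 :: real^'p^'p) = 0"
      using zero by blast
    then have "mat_of (Symmat (mat 1 :: real^'p^'p)) = 0"
      by simp
    then have "mat 1 = (0 :: real^'p^'p)"
      by (subst (asm) Symmat_inverse) (simp_all add: transpose_mat)
    then have "(mat 1 :: real^'p^'p) $ undefined $ undefined = 0"
      by simp
    then show False
      by (simp add: mat_def)
  qed
  have iff: "(\<forall>u\<in>C. x \<bullet> u = 0) \<longleftrightarrow> x = 0" for x
    using zero[of x] by (metis inner_zero_left)
  show ?thesis
    by (intro exI[of _ C] conjI ballI allI nonempty fin' orth iff)
qed

instantiation symmat :: (finite) euclidean_space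
begin

definition "Basis = (SOME B :: 'a symmat set. B \<noteq> {} \<and> finite B \<and>
     (\<forall>u\<in>B. \<forall>v\<in>B. u \<bullet> v = (if u = v then 1 else 0)) \<and>
     (\<forall>x. (\<forall>u\<in>B. x \<bullet> u = 0) \<longleftrightarrow> x = 0))"

instance
proof
  have B: "(Basis :: 'a symmat set) \<noteq> {} \<and> finite (Basis :: 'a symmat set) \<and>
     (\<forall>u\<in>Basis. \<forall>v\<in>(Basis :: 'a symmat set). u \<bullet> v = (if u = v then 1 else (0 :: real))) \<and>
     (\<forall>x :: 'a symmat. (\<forall>u\<in>Basis. x \<bullet> u = 0) \<longleftrightarrow> x = 0)"
    unfolding Basis_symmat_def by (rule someI_ex[OF symmat_orthonormal_basis_exists])
  show "(Basis :: 'a symmat set) \<noteq> {}"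
    by (rule B[THEN conjunct1])
  show "finite (Basis :: 'a symmat set)"
    by (rule B[THEN conjunct2, THEN conjunct1])
  show "u \<bullet> v = (if u = v then 1 else 0)" if "u \<in> Basis" "v \<in> Basis" for u v :: "'a symmat"
    using B[THEN conjunct2, THEN conjunct2, THEN conjunct1, rule_format, OF that] .
  show "(\<forall>u\<in>Basis. x \<bullet> u = 0) \<longleftrightarrow> x = 0" for x :: "'a symmat"
    by (rule B[THEN conjunct2, THEN conjunct2, THEN conjunct2, THEN spec])
qed

end

definition psd_cone :: "('p::finite) symmat set" where
  "psd_cone = {X. \<forall>v. 0 \<le> v \<bullet> (mat_of X *v v)}"

definition nsd_cone :: "('p::finite) symmat set" where
  "nsd_cone = uminus ` psd_cone"


section \<open>The Moore--Penrose pseudo-inverse\<close>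

definition is_pseudo_inverse :: "real^'n^'m \<Rightarrow> real^'m^'n \<Rightarrow> bool" where
  "is_pseudo_inverse A X \<longleftrightarrow>
     A ** X ** A = A \<and> X ** A ** X = X \<and>
     transpose (A ** X) = A ** X \<and> transpose (X ** A) = X ** A"

definition pseudo_inverse :: "real^'n^'m \<Rightarrow> real^'m^'n" where
  "pseudo_inverse A = (THE X. is_pseudo_inverse A X)"

lemma is_pseudo_inverse_unique:
  assumes X: "is_pseudo_inverse A X" and Y: "is_pseudo_inverse A Y"
  shows "X = Y"
proof -
  note X' = X[unfolded is_pseudo_inverse_def] and Y' = Y[unfolded is_pseudo_inverse_def]
  have "A ** X = transpose ((A ** Y ** A) ** X)"
    using X' Y' by simp
  also have "\<dots> = transpose ((A ** Y) ** (A ** X))"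
    by (simp add: matrix_mul_assoc)
  also have "\<dots> = (A ** X) ** (A ** Y)"
    using X' Y' by (simp only: matrix_transpose_mul)
  also have "\<dots> = (A ** X ** A) ** Y"
    by (simp add: matrix_mul_assoc)
  finally have AX: "A ** X = A ** Y"
    using X' by simp
  have "X ** A = transpose (X ** (A ** Y ** A))"
    using X' Y' by simp
  also have "\<dots> = transpose ((X ** A) ** (Y ** A))"
    by (simp add: matrix_mul_assoc)
  also have "\<dots> = (Y ** A) ** (X ** A)"
    using X' Y' by (simp only: matrix_transpose_mul)
  also have "\<dots> = Y ** (A ** X ** A)"
    by (simp add: matrix_mul_assoc)
  finally have XA: "X ** A = Y ** A"
    using X' by simp
  have "X = (X ** A) ** X"
    using X' by simp
  also have "\<dots> = Y ** (A ** X)"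
    by (simp add: XA matrix_mul_assoc)
  also have "\<dots> = Y ** A ** Y"
    by (simp add: AX matrix_mul_assoc)
  finally show ?thesis
    using Y' by simp
qed

lemma orthogonal_projection_exists:
  fixes V :: "'a::euclidean_space set"
  assumes "subspace V"
  obtains P where "linear P" "\<And>x. P x \<in> V" "\<And>x. x \<in> V \<Longrightarrow> P x = x"
    "\<And>x v. v \<in> V \<Longrightarrow> (x - P x) \<bullet> v = 0" "\<And>x y. P x \<bullet> y = x \<bullet> P y"
proof -
  have "\<exists>y. y \<in> V \<and> (\<forall>v\<in>V. (x - y) \<bullet> v = 0)" for x
    using orthogonal_subspace_decomp_exists[of V x] assms
    by (metis add_diff_cancel_left' orthogonal_def span_eq_iff)
  then obtain P where P: "\<And>x. P x \<in> V" "\<And>x v. v \<in> V \<Longrightarrow> (x - P x) \<bullet> v = 0"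
    by metis
  have uniq: "P x = y" if "y \<in> V" "\<And>v. v \<in> V \<Longrightarrow> (x - y) \<bullet> v = 0" for x y
  proof -
    have d: "P x - y \<in> V"
      using assms P(1) that(1) by (simp add: subspace_diff)
    have "(P x - y) \<bullet> (P x - y) = (x - y) \<bullet> (P x - y) - (x - P x) \<bullet> (P x - y)"
      by (simp add: inner_diff_left)
    also have "\<dots> = 0"
      using d P(2) that(2) by simp
    finally show ?thesis by simp
  qed
  have "linear P"
  proof (rule linearI)
    show "P (x + y) = P x + P y" for x y
    proof (rule uniq)
      show "P x + P y \<in> V" using assms P(1) by (simp add: subspace_add)
      show "(x + y - (P x + P y)) \<bullet> v = 0" if "v \<in> V" for v
        using P(2)[OF that, of x] P(2)[OF that, of y] by (simp add: inner_diff_left inner_add_left)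
    qed
    show "P (r *\<^sub>R x) = r *\<^sub>R P x" for r x
    proof (rule uniq)
      show "r *\<^sub>R P x \<in> V" using assms P(1) by (simp add: subspace_scale)
      show "(r *\<^sub>R x - r *\<^sub>R P x) \<bullet> v = 0" if "v \<in> V" for v
        using P(2)[OF that, of x] by (simp add: inner_diff_left)
    qed
  qed
  moreover have "P x = x" if "x \<in> V" for x
    using uniq[of x x] that by simp
  moreover have "P x \<bullet> y = x \<bullet> P y" for x y
  proof -
    have "(x - P x) \<bullet> P y = 0" "(y - P y) \<bullet> P x = 0"
      by (simp_all add: P)
    then show ?thesis
      by (simp add: inner_diff_left inner_commute[of y] inner_commute[of "P y"])
  qed
  ultimately show ?thesis
    using that P by blast
qed

lemma is_pseudo_inverse_exists:
  fixes A :: "real^'n^'m"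
  shows "\<exists>X. is_pseudo_inverse A X"
proof -
  define f where "f = (*v) A"
  define f' where "f' = (*v) (transpose A)"
  have f: "linear f" and f': "linear f'"
    unfolding f_def f'_def by simp_all
  have adj: "f x \<bullet> y = x \<bullet> f' y" for x y
    using adjoint_clauses(1)[OF f] by (simp add: f_def f'_def adjoint_matrix)
  obtain P where P: "linear P" "\<And>x. P x \<in> range f'" "\<And>x. x \<in> range f' \<Longrightarrow> P x = x"
    "\<And>x v. v \<in> range f' \<Longrightarrow> (x - P x) \<bullet> v = 0" "\<And>x y. P x \<bullet> y = x \<bullet> P y"
    by (rule orthogonal_projection_exists[OF linear_subspace_image[OF f' subspace_UNIV]], rule that)
  obtain R where R: "linear R" "\<And>x. R x \<in> range f" "\<And>x. x \<in> range f \<Longrightarrow> R x = x"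
    "\<And>x v. v \<in> range f \<Longrightarrow> (x - R x) \<bullet> v = 0" "\<And>x y. R x \<bullet> y = x \<bullet> R y"
    by (rule orthogonal_projection_exists[OF linear_subspace_image[OF f subspace_UNIV]], rule that)
  have fP: "f (P x) = f x" for x
  proof -
    have "f (x - P x) \<bullet> f (x - P x) = 0"
      by (simp add: adj P(4))
    then show ?thesis by (simp add: linear_diff[OF f])
  qed
  have "inj_on f (range f')"
  proof (rule inj_onI)
    fix x y assume xy: "x \<in> range f'" "y \<in> range f'" "f x = f y"
    then obtain u where u: "x - y = f' u"
      using linear_diff[OF f'] by (metis imageE)
    have "(x - y) \<bullet> (x - y) = f (x - y) \<bullet> u"
      by (simp add: adj u)
    then show "x = y"
      using xy(3) by (simp add: linear_diff[OF f])
  qed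
  then obtain g where g: "linear g" "\<And>v. v \<in> range f' \<Longrightarrow> g (f v) = v"
    using linear_exists_left_inverse_on[OF f linear_subspace_image[OF f' subspace_UNIV]] by blast
  define h where "h = P \<circ> g \<circ> R"
  have h: "linear h"
    unfolding h_def by (intro linear_compose P(1) g(1) R(1))
  have fh: "f (h y) = R y" for y
  proof -
    obtain x where x: "R y = f x" using R(2)[of y] by blast
    have "h y = P x"
      using g(2)[OF P(2)[of x]] by (simp add: h_def x fP P(2,3))
    then show ?thesis by (simp add: fP x)
  qed
  have hf: "h (f x) = P x" for x
  proof -
    have "g (f x) = P x" using g(2)[OF P(2)[of x]] by (simp add: fP)
    then show ?thesis by (simp add: h_def R(3) P(2,3))
  qed
  have Ph: "P (h y) = h y" for y
    by (simp add: h_def P(2,3))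
  have A: "matrix f = A" by (simp add: f_def)
  have AX: "A ** matrix h = matrix R"
    using matrix_compose[OF h f] A fh by (simp add: comp_def)
  have XA: "matrix h ** A = matrix P"
    using matrix_compose[OF f h] A hf by (simp add: comp_def)
  have "A ** matrix h ** A = matrix (R \<circ> f)"
    using AX A matrix_compose[OF f R(1)] by simp
  moreover have "R \<circ> f = f" by (simp add: fun_eq_iff R(3))
  moreover have "matrix h ** A ** matrix h = matrix (P \<circ> h)"
    using XA matrix_compose[OF h P(1)] by simp
  moreover have "P \<circ> h = h" by (simp add: fun_eq_iff Ph)
  moreover have "transpose (matrix R) = matrix R"
    using matrix_adjoint[OF R(1)] adjoint_unique[of R R] R(5) by simp
  moreover have "transpose (matrix P) = matrix P"
    using matrix_adjoint[OF P(1)] adjoint_unique[of P P] P(5) by simp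
  ultimately have "is_pseudo_inverse A (matrix h)"
    by (simp add: is_pseudo_inverse_def AX XA A)
  then show ?thesis ..
qed

lemma is_pseudo_inverse_pseudo_inverse: "is_pseudo_inverse A (pseudo_inverse A)"
  unfolding pseudo_inverse_def
  using is_pseudo_inverse_exists is_pseudo_inverse_unique by (metis theI)


section \<open>Notions of convex analysis\<close>

definition tangent_cone :: "'a::real_normed_vector set \<Rightarrow> 'a \<Rightarrow> 'a set" where
  "tangent_cone C x = {d. x \<in> C \<and> (\<exists>(t :: nat \<Rightarrow> real) d'.
     (\<forall>k. 0 < t k) \<and> t \<longlonglongrightarrow> 0 \<and> d' \<longlonglongrightarrow> d \<and> (\<forall>k. x + t k *\<^sub>R d' k \<in> C))}"

definition normal_cone :: "'a::real_inner set \<Rightarrow> 'a \<Rightarrow> 'a set" where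
  "normal_cone C x = {v. x \<in> C \<and> (\<forall>y\<in>C. v \<bullet> (y - x) \<le> 0)}"

definition support_function :: "'a::real_inner set \<Rightarrow> 'a \<Rightarrow> ereal" where
  "support_function C w = (SUP x\<in>C. ereal (w \<bullet> x))"

text \<open>Both the function and its one-sided directional derivative are extended-real valued.
  The difference is meaningful only at points where \<^term>\<open>f\<close> is finite.\<close>

definition directional_derivative :: "('a::real_vector \<Rightarrow> ereal) \<Rightarrow> 'a \<Rightarrow> 'a \<Rightarrow> ereal" where
  "directional_derivative f z u = Lim (at_right 0) (\<lambda>t::real. (f (z + t *\<^sub>R u) - f z) / ereal t)"


section \<open>The primal problem and the conditions attached to it\<close>

definition primal_feasible ::
  "(('p::finite) symmat \<Rightarrow> real^'m) \<Rightarrow> real^'m \<Rightarrow> 'p symmat set \<Rightarrow> ('p symmat \<times> 'p symmat) set" where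
  "primal_feasible A b P = {(x, u). A x = b \<and> x - u = 0 \<and> x \<in> psd_cone \<and> u \<in> P}"

definition primal_objective ::
  "(('p::finite) symmat \<Rightarrow> 'p symmat) \<Rightarrow> 'p symmat \<Rightarrow> 'p symmat \<Rightarrow> real" where
  "primal_objective Q c x = 1/2 * (x \<bullet> Q x) + c \<bullet> x"

definition primal_optimal ::
  "(('p::finite) symmat \<Rightarrow> 'p symmat) \<Rightarrow> 'p symmat \<Rightarrow> ('p symmat \<Rightarrow> real^'m) \<Rightarrow> real^'m \<Rightarrow>
   'p symmat set \<Rightarrow> 'p symmat \<Rightarrow> 'p symmat \<Rightarrow> bool" where
  "primal_optimal Q c A b P x u \<longleftrightarrow>
     (x, u) \<in> primal_feasible A b P \<and>
     (\<forall>(x', u') \<in> primal_feasible A b P. primal_objective Q c x \<le> primal_objective Q c x')"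

definition multipliers ::
  "(('p::finite) symmat \<Rightarrow> 'p symmat) \<Rightarrow> 'p symmat \<Rightarrow> ('p symmat \<Rightarrow> real^'m) \<Rightarrow> real^'m \<Rightarrow>
   'p symmat set \<Rightarrow> 'p symmat \<Rightarrow> 'p symmat \<Rightarrow>
   ('p symmat \<times> (real^'m) \<times> 'p symmat \<times> 'p symmat) set" where
  "multipliers Q c A b P x u = {(s, y, z, v).
     Q x + c - adjoint A y - z - s = 0 \<and> z + v = 0 \<and> b - A x = 0 \<and> u - x = 0 \<and>
     s \<in> normal_cone nsd_cone (- x) \<and> v \<in> normal_cone P u}"

definition critical_cone ::
  "(('p::finite) symmat \<Rightarrow> 'p symmat) \<Rightarrow> 'p symmat \<Rightarrow> ('p symmat \<Rightarrow> real^'m) \<Rightarrow>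
   'p symmat set \<Rightarrow> 'p symmat \<Rightarrow> 'p symmat \<Rightarrow> ('p symmat \<times> 'p symmat) set" where
  "critical_cone Q c A P x u = {(dx, du).
     A dx = 0 \<and> du - dx = 0 \<and> dx \<in> tangent_cone psd_cone x \<and> du \<in> tangent_cone P u \<and>
     (Q x + c) \<bullet> dx = 0}"

text \<open>The trace below is the inner product of \<open>s\<close> with \<open>d x\<^sup>\<dagger> d\<close>, written for matrices.\<close>

definition sigma_term ::
  "('p::finite) symmat \<Rightarrow> 'p symmat \<Rightarrow> 'p symmat \<Rightarrow> real" where
  "sigma_term s x d = trace (mat_of s ** (mat_of d ** pseudo_inverse (mat_of x) ** mat_of d))"

text \<open>The supremum may be infinite, hence it is taken in the extended reals.\<close>

definition primal_SOSC ::
  "(('p::finite) symmat \<Rightarrow> 'p symmat) \<Rightarrow> 'p symmat \<Rightarrow> ('p symmat \<Rightarrow> real^'m) \<Rightarrow> real^'m \<Rightarrow>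
   'p symmat set \<Rightarrow> 'p symmat \<Rightarrow> 'p symmat \<Rightarrow> bool" where
  "primal_SOSC Q c A b P x u \<longleftrightarrow>
     (\<forall>(dx, du) \<in> critical_cone Q c A P x u. (dx, du) \<noteq> (0, 0) \<longrightarrow>
       (SUP (s, y, z, v) \<in> multipliers Q c A b P x u.
          ereal (Q dx \<bullet> dx + 2 * sigma_term s x dx)) > 0)"


section \<open>The constraint qualification for the dual problem\<close>

definition theta :: "('p::finite) symmat set \<Rightarrow> 'p symmat \<Rightarrow> ereal" where
  "theta P z = support_function P (- z)"

definition S_set ::
  "('p::finite) symmat set \<Rightarrow> 'p symmat \<Rightarrow> 'p symmat \<Rightarrow> 'p symmat set" where
  "S_set P x z = {u. ereal (u \<bullet> x) + directional_derivative (theta P) z u = 0}"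

text \<open>Addition of sets is the Minkowski sum. As \<open>-\<close> on sets is the set difference,
  the Minkowski difference with \<open>Q W\<close> is written as a sum with \<open>uminus ` Q ` W\<close>.\<close>

definition dual_extended_SRCQ ::
  "(('p::finite) symmat \<Rightarrow> 'p symmat) \<Rightarrow> 'p symmat \<Rightarrow> ('p symmat \<Rightarrow> real^'m) \<Rightarrow> real^'m \<Rightarrow>
   'p symmat set \<Rightarrow> 'p symmat set \<Rightarrow> 'p symmat \<Rightarrow> 'p symmat \<Rightarrow> bool" where
  "dual_extended_SRCQ Q c A b P W x u \<longleftrightarrow>
     convex hull (\<Union>(s, y, z, v) \<in> multipliers Q c A b P x u.
        (tangent_cone psd_cone s \<inter> {x}\<^sup>\<bottom>) + S_set P x z)
     + range (adjoint A) + uminus ` Q ` W = UNIV"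

end

theory Submission
  imports Defs
begin

text \<open>
  Both conditions say that there is no nonzero matrix \<open>e\<close> with \<open>A e = 0\<close>, \<open>Q e = 0\<close>, \<open>e\<close> tangent at
  \<open>x\<close> to the positive semidefinite cone and to \<open>P\<close>, and such that \<open>z \<bullet> e = 0\<close> and \<open>e s = 0\<close> (as a
  product of matrices) for every multiplier \<open>(s, y, z, v)\<close>.

  For the second-order condition, both terms under the supremum are nonnegative, so the condition
  fails at a critical direction \<open>d\<close> exactly when \<open>Q d = 0\<close> and \<open>\<langle>s, d x\<^sup>\<dagger> d\<rangle> = 0\<close> for all
  multipliers. As \<open>Q x + c = A\<^sup>* y + z + s\<close>, criticality of a direction with \<open>A d = 0\<close> that is tangent
  to both sets means \<open>z \<bullet> d = s \<bullet> d = 0\<close>. Now \<open>s \<bullet> d = 0\<close>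
  makes every \<open>d s v\<close> orthogonal to the kernel of \<open>x\<close>, and the vanishing curvature term puts it into
  that kernel; together they say \<open>d s = 0\<close> (lemma \<open>sigma_term_zero_iff\<close>).

  For the constraint qualification, the left-hand side is a convex set, so it is the whole space
  unless some nonzero \<open>e\<close> is bounded below on it. Such an \<open>e\<close> annihilates the ranges of the adjoint
  of \<open>A\<close> and of \<open>Q\<close>, and it is in the dual cone of both summands belonging to each multiplier.
  The dual of \<open>T(s) \<inter> x\<^sup>\<bottom>\<close> consists of the \<open>e\<close> tangent at \<open>x\<close> with \<open>e s = 0\<close> (lemmas
  \<open>inner_nonneg_tangent_cone_perp\<close> and \<open>tangent_cone_perp_dual_necessary\<close>). This is smaller than
  \<open>T(x) \<inter> s\<^sup>\<bottom>\<close>, and the difference is what the curvature term measures. The dual of \<open>S\<close> consists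
  of the \<open>e\<close> tangent to \<open>P\<close> at \<open>x\<close> with \<open>z \<bullet> e = 0\<close>: one inclusion holds because \<open>S\<close> contains the negative
  normals and the multiples of \<open>z\<close> (lemma \<open>S_set_contains\<close>), the other because tangent directions of a
  polyhedron are feasible (lemma \<open>S_set_inner_nonneg\<close>).
\<close>

section \<open>Tangent cones of convex sets\<close>

lemma tangent_cone_imp_normal_cone_le:
  fixes C :: "'a::real_inner set"
  assumes d: "d \<in> tangent_cone C x" and v: "v \<in> normal_cone C x"
  shows "v \<bullet> d \<le> 0"
proof -
  obtain t :: "nat \<Rightarrow> real" and d' where t: "\<And>k. 0 < t k" "d' \<longlonglongrightarrow> d"
    "\<And>k. x + t k *\<^sub>R d' k \<in> C"
    using d by (auto simp: tangent_cone_def)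
  have "v \<bullet> d' k \<le> 0" for k
  proof -
    have "v \<bullet> (x + t k *\<^sub>R d' k - x) \<le> 0"
      using v t(3)[of k] unfolding normal_cone_def by blast
    then show ?thesis
      using t(1)[of k] by (simp add: mult_le_0_iff)
  qed
  moreover have "(\<lambda>k. v \<bullet> d' k) \<longlonglongrightarrow> v \<bullet> d"
    by (intro tendsto_intros t(2))
  ultimately show ?thesis
    by (intro LIMSEQ_le_const2[of "\<lambda>k. v \<bullet> d' k"]) auto
qed

text \<open>For a convex set the tangent cone is the polar of the normal cone. A direction outside the
  closed cone generated by \<open>C - x\<close> is separated from it by some \<open>a\<close>, and \<open>- a\<close> is then a normal
  at \<open>x\<close>. A direction in the closure is a limit of \<open>r\<^sub>k (y\<^sub>k - x)\<close>, which become admissible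
  difference quotients once the step lengths are at most \<open>1 / r\<^sub>k\<close>.\<close>

lemma tangent_cone_convex_iff:
  fixes C :: "'a::euclidean_space set"
  assumes C: "convex C" and x: "x \<in> C"
  shows "d \<in> tangent_cone C x \<longleftrightarrow> (\<forall>v\<in>normal_cone C x. v \<bullet> d \<le> 0)"
proof
  show "\<forall>v\<in>normal_cone C x. v \<bullet> d \<le> 0" if "d \<in> tangent_cone C x"
    using that tangent_cone_imp_normal_cone_le by blast
next
  assume d: "\<forall>v\<in>normal_cone C x. v \<bullet> d \<le> 0"
  define K where "K = (\<Union>r\<in>{0<..}. (\<lambda>y. r *\<^sub>R (y - x)) ` C)"
  have KI: "r *\<^sub>R (y - x) \<in> K" if "0 < r" "y \<in> C" for r y
    using that by (auto simp: K_def)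
  have "convex K"
  proof (rule convexI)
    fix p q and a b :: real
    assume "p \<in> K" "q \<in> K" and ab: "0 \<le> a" "0 \<le> b" "a + b = 1"
    then obtain r y r' y' where p: "p = r *\<^sub>R (y - x)" "0 < r" "y \<in> C"
      and q: "q = r' *\<^sub>R (y' - x)" "0 < r'" "y' \<in> C"
      by (auto simp: K_def)
    define m where "m = a * r + b * r'"
    have "m > 0"
      using ab p(2) q(2) unfolding m_def
      by (cases "a = 0") (auto intro: add_pos_nonneg)
    have "(a * r / m) *\<^sub>R y + (b * r' / m) *\<^sub>R y' \<in> C"
      using \<open>m > 0\<close> ab p q
      by (intro convexD[OF C]) (auto simp: add_divide_distrib[symmetric] m_def[symmetric])
    note KI[OF \<open>m > 0\<close> this]
    also have "m *\<^sub>R ((a * r / m) *\<^sub>R y + (b * r' / m) *\<^sub>R y' - x)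
        = (a * r) *\<^sub>R y + (b * r') *\<^sub>R y' - m *\<^sub>R x"
      using \<open>m > 0\<close> by (simp add: scaleR_diff_right scaleR_add_right)
    also have "\<dots> = a *\<^sub>R p + b *\<^sub>R q"
      by (simp add: p(1) q(1) m_def algebra_simps)
    finally show "a *\<^sub>R p + b *\<^sub>R q \<in> K" .
  qed
  have "0 \<in> K"
    using KI[OF zero_less_one x] by simp
  have "d \<in> closure K"
  proof (rule ccontr)
    assume "d \<notin> closure K"
    moreover have "convex (closure K)"
      using \<open>convex K\<close> by (rule convex_closure)
    ultimately obtain a \<beta> where a: "a \<bullet> d < \<beta>" "\<And>k. k \<in> closure K \<Longrightarrow> a \<bullet> k > \<beta>"
      using separating_hyperplane_closed_point[of "closure K" d] by auto
    have aK: "a \<bullet> k > \<beta>" if "k \<in> K" for k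
      using a(2) closure_subset that by blast
    have "\<beta> < 0"
      using aK[OF \<open>0 \<in> K\<close>] by simp
    have "a \<bullet> (y - x) \<ge> 0" if "y \<in> C" for y
    proof (rule ccontr)
      assume n: "\<not> a \<bullet> (y - x) \<ge> 0"
      then have "\<beta> / (a \<bullet> (y - x)) > 0"
        using \<open>\<beta> < 0\<close> by (simp add: zero_less_divide_iff)
      from aK[OF KI[OF this that]] n show False
        by simp
    qed
    then have "- a \<in> normal_cone C x"
      using x by (simp add: normal_cone_def)
    with d a(1) \<open>\<beta> < 0\<close> show False
      by fastforce
  qed
  then obtain d' where d': "\<And>k. d' k \<in> K" "d' \<longlonglongrightarrow> d"
    by (metis closure_sequential)
  have "\<forall>k. \<exists>r y. 0 < r \<and> y \<in> C \<and> d' k = r *\<^sub>R (y - x)"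
    using d'(1) by (fastforce simp: K_def)
  then obtain r y where ry: "\<And>k::nat. 0 < r k" "\<And>k. y k \<in> C" "\<And>k. d' k = r k *\<^sub>R (y k - x)"
    by metis
  \<comment> \<open>Steps of length at most \<open>1 / r k\<close> stay on the segment from \<open>x\<close> to \<open>y k\<close>.\<close>
  define t :: "nat \<Rightarrow> real" where "t k = min (1 / r k) (inverse (real (Suc k)))" for k
  have t0: "0 < t k" for k
    using ry(1)[of k] by (simp add: t_def)
  have "t \<longlonglongrightarrow> 0"
    by (rule tendsto_sandwich[OF _ _ tendsto_const LIMSEQ_inverse_real_of_nat])
      (auto intro!: always_eventually less_imp_le[OF t0], simp add: t_def)
  moreover have "x + t k *\<^sub>R d' k \<in> C" for k
  proof -
    have "t k * r k \<le> 1"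
      using ry(1)[of k] by (simp add: t_def min_def field_simps)
    then have "(1 - t k * r k) *\<^sub>R x + (t k * r k) *\<^sub>R y k \<in> C"
      using t0[of k] ry(1)[of k] x ry(2)[of k] by (intro convexD[OF C]) auto
    then show ?thesis
      by (simp add: ry(3) algebra_simps)
  qed
  ultimately show "d \<in> tangent_cone C x"
    using x t0 d'(2) unfolding tangent_cone_def by blast
qed

lemma tangent_cone_scaleR:
  fixes C :: "'a::euclidean_space set"
  assumes "convex C" "d \<in> tangent_cone C x" "0 \<le> r"
  shows "r *\<^sub>R d \<in> tangent_cone C x"
proof -
  have x: "x \<in> C"
    using assms(2) by (simp add: tangent_cone_def)
  show ?thesis
    using assms tangent_cone_convex_iff[OF assms(1) x] by (simp add: mult_nonneg_nonpos)
qed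

text \<open>This is where polyhedrality enters: an active constraint forces \<open>a \<bullet> d \<le> 0\<close>, an inactive one
  tolerates a short step in any direction, and there are finitely many constraints.\<close>

lemma polyhedron_tangent_cone_feasible:
  fixes P :: "'a::euclidean_space set"
  assumes P: "polyhedron P" and d: "d \<in> tangent_cone P x"
  obtains t where "0 < t" "x + t *\<^sub>R d \<in> P"
proof -
  obtain F where F: "finite F" "P = \<Inter> F" "\<forall>h\<in>F. \<exists>a b. a \<noteq> 0 \<and> h = {x. a \<bullet> x \<le> b}"
    using P by (auto simp: polyhedron_def)
  obtain t :: "nat \<Rightarrow> real" and d' where t: "\<And>k. 0 < t k" "d' \<longlonglongrightarrow> d"
    "\<And>k. x + t k *\<^sub>R d' k \<in> P"
    using d by (auto simp: tangent_cone_def)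
  have x: "x \<in> P"
    using d by (simp add: tangent_cone_def)
  have "eventually (\<lambda>r. x + r *\<^sub>R d \<in> h) (at_right (0::real))" if h: "h \<in> F" for h
  proof -
    obtain a b where ab: "h = {x. a \<bullet> x \<le> b}"
      using F(3) h by blast
    have xh: "a \<bullet> x \<le> b"
      using x F(2) h ab by blast
    show ?thesis
    proof (cases "a \<bullet> x = b")
      case True
      have "a \<in> normal_cone h x"
        using True by (simp add: normal_cone_def ab inner_diff_right)
      moreover have "d \<in> tangent_cone h x"
        using d h F(2) unfolding tangent_cone_def by blast
      ultimately have "a \<bullet> d \<le> 0"
        by (rule tangent_cone_imp_normal_cone_le[rotated])
      then show ?thesis
        using True unfolding eventually_at_right_field
        by (auto simp: ab inner_add_right mult_nonneg_nonpos intro!: exI[of _ 1])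
    next
      case False
      have "((\<lambda>r. a \<bullet> (x + r *\<^sub>R d)) \<longlongrightarrow> a \<bullet> (x + 0 *\<^sub>R d)) (at_right 0)"
        by (intro tendsto_intros)
      then have "eventually (\<lambda>r. a \<bullet> (x + r *\<^sub>R d) < b) (at_right 0)"
        using False xh by (intro order_tendstoD(2)) auto
      then show ?thesis
        by eventually_elim (simp add: ab)
    qed
  qed
  then have "eventually (\<lambda>r. \<forall>h\<in>F. x + r *\<^sub>R d \<in> h) (at_right (0::real))"
    using F(1) by (intro eventually_ball_finite) auto
  then have "eventually (\<lambda>r. 0 < r \<and> x + r *\<^sub>R d \<in> P) (at_right (0::real))"
    using eventually_at_right_less[of "0::real"] by eventually_elim (simp add: F(2))
  from eventually_happens'[OF trivial_limit_at_right_real this] show ?thesis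
    using that by blast
qed

section \<open>Positive semidefinite matrices\<close>

lemma symmetric_matrix_inner:
  fixes M :: "real^'n^'n"
  assumes "transpose M = M"
  shows "(M *v v) \<bullet> w = v \<bullet> (M *v w)"
  using dot_lmul_matrix[of v M w] by (simp add: assms flip: transpose_matrix_vector)

lemma mat_of_inner_commute: "(mat_of X *v v) \<bullet> w = v \<bullet> (mat_of X *v w)"
  by (rule symmetric_matrix_inner) simp

definition rank_one :: "real^('p::finite) \<Rightarrow> 'p symmat" where
  "rank_one v = Symmat (\<chi> i j. v $ i * v $ j)"

definition sym_product :: "real^('p::finite) \<Rightarrow> real^'p \<Rightarrow> 'p symmat" where
  "sym_product v w = Symmat (\<chi> i j. v $ i * w $ j + w $ i * v $ j)"

lemma mat_of_rank_one: "mat_of (rank_one v) = (\<chi> i j. v $ i * v $ j)"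
  by (simp add: rank_one_def Symmat_inverse transpose_def vec_eq_iff mult.commute)

lemma mat_of_sym_product: "mat_of (sym_product v w) = (\<chi> i j. v $ i * w $ j + w $ i * v $ j)"
  by (simp add: sym_product_def Symmat_inverse transpose_def vec_eq_iff mult.commute)

lemma rank_one_mult: "mat_of (rank_one v) *v w = (v \<bullet> w) *\<^sub>R v"
  by (simp add: mat_of_rank_one vec_eq_iff matrix_vector_mult_def inner_vec_def
      sum_distrib_left ac_simps)

lemma sym_product_mult:
  "mat_of (sym_product v w) *v a = (w \<bullet> a) *\<^sub>R v + (v \<bullet> a) *\<^sub>R w"
  by (simp add: mat_of_sym_product vec_eq_iff matrix_vector_mult_def inner_vec_def
      sum_distrib_left sum.distrib algebra_simps)

lemma inner_rank_one: "X \<bullet> rank_one v = v \<bullet> (mat_of X *v v)"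
  by (simp add: inner_symmat_eq mat_of_rank_one inner_vec_def matrix_vector_mult_def
      sum_distrib_left ac_simps)

lemma inner_sym_product: "X \<bullet> sym_product v w = 2 * (v \<bullet> (mat_of X *v w))"
proof -
  have "X \<bullet> sym_product v w = v \<bullet> (mat_of X *v w) + w \<bullet> (mat_of X *v v)"
    by (simp add: inner_symmat_eq mat_of_sym_product inner_vec_def matrix_vector_mult_def
        sum_distrib_left ac_simps sum.distrib distrib_left)
  then show ?thesis
    by (simp add: inner_commute[of w] mat_of_inner_commute)
qed

lemma rank_one_in_psd_cone: "rank_one v \<in> psd_cone"
  by (simp add: psd_cone_def rank_one_mult inner_commute)

lemma convex_psd_cone: "convex psd_cone"
  by (rule convexI)
    (auto simp: psd_cone_def matrix_vector_mult_add_rdistrib inner_add_right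
      simp flip: scaleR_matrix_vector_assoc)

lemma zero_in_psd_cone: "0 \<in> psd_cone"
  by (simp add: psd_cone_def)

text \<open>For \<open>w + r v\<close> the form equals \<open>b + 2 r a\<close>, which is affine in \<open>r\<close> because \<open>v\<close> is isotropic;
  an affine function bounded below is constant.\<close>

lemma semidefinite_form_null:
  fixes f :: "'a::real_inner \<Rightarrow> 'a"
  assumes f: "linear f" "\<And>x y. f x \<bullet> y = x \<bullet> f y"
    and V: "subspace V" "\<And>w. w \<in> V \<Longrightarrow> 0 \<le> w \<bullet> f w"
    and v: "v \<in> V" "v \<bullet> f v = 0" and w: "w \<in> V"
  shows "w \<bullet> f v = 0"
proof (rule ccontr)
  define a where "a = w \<bullet> f v"
  define b where "b = w \<bullet> f w"
  assume "w \<bullet> f v \<noteq> 0"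
  then have a: "a \<noteq> 0" by (simp add: a_def)
  have vw: "v \<bullet> f w = a"
    by (metis a_def inner_commute f(2))
  have q: "0 \<le> b + 2 * r * a" for r
  proof -
    have "0 \<le> (w + r *\<^sub>R v) \<bullet> f (w + r *\<^sub>R v)"
      using V(1) v(1) w by (intro V(2)) (simp add: subspace_add subspace_scale)
    also have "\<dots> = b + 2 * r * a"
      using v(2) vw by (simp add: linear_add[OF f(1)] linear_scale[OF f(1)] inner_add_left
          inner_add_right flip: a_def b_def)
    finally show ?thesis .
  qed
  from q[of "- (b + 1) / (2 * a)"] a show False
    by (simp add: field_simps)
qed

lemma form_null_on_subspace:
  assumes "subspace V" "\<And>w. w \<in> V \<Longrightarrow> 0 \<le> w \<bullet> (mat_of D *v w)"
    and "v \<in> V" "v \<bullet> (mat_of D *v v) = 0" and "w \<in> V"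
  shows "w \<bullet> (mat_of D *v v) = 0"
  using semidefinite_form_null[OF matrix_vector_mul_linear mat_of_inner_commute] assms by blast

lemma subspace_kernel_mat_of: "subspace {v. mat_of X *v v = 0}"
  using linear_subspace_kernel[OF matrix_vector_mul_linear[of "mat_of X"]] by simp

text \<open>A substitute for the spectral theorem, obtained by repeated Schur complements: if
  \<open>c = a \<bullet> X a\<close> is positive, then \<open>X - (X a) (X a)\<^sup>T / c\<close> is again positive semidefinite and its kernel
  contains that of \<open>X\<close> and also \<open>a\<close>. The vectors found in this way lie in the range of \<open>X\<close>.\<close>

lemma psd_cone_decomposition:
  fixes X :: "('p::finite) symmat"
  assumes "X \<in> psd_cone"
  obtains vs where "X = (\<Sum>v\<leftarrow>vs. rank_one v)" "set vs \<subseteq> range ((*v) (mat_of X))"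
  using assms
proof (induction "DIM(real^'p) - dim {v. mat_of X *v v = 0}" arbitrary: X thesis
    rule: less_induct)
  case less
  have psd: "0 \<le> v \<bullet> (mat_of X *v v)" for v
    using less.prems(2) by (simp add: psd_cone_def)
  show ?case
  proof (cases "\<forall>a. a \<bullet> (mat_of X *v a) = 0")
    case True
    have "mat_of X *v v = 0" for v
      using form_null_on_subspace[OF subspace_UNIV psd UNIV_I, of v "mat_of X *v v"] True by simp
    then have "X = 0"
      by (simp add: symmat_eq_iff matrix_eq)
    then show ?thesis
      using less.prems(1)[of "[]"] by simp
  next
    case False
    then obtain a where a: "a \<bullet> (mat_of X *v a) \<noteq> 0" by blast
    define c where "c = a \<bullet> (mat_of X *v a)"
    have c: "c > 0" using a psd[of a] by (simp add: c_def)
    define w where "w = (1 / sqrt c) *\<^sub>R (mat_of X *v a)"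
    define Y where "Y = X - rank_one w"
    have Y: "mat_of Y *v v = mat_of X *v (v - ((a \<bullet> (mat_of X *v v)) / c) *\<^sub>R a)" for v
      using c by (simp add: Y_def matrix_vector_mult_diff_rdistrib rank_one_mult
          matrix_vector_mult_diff_distrib matrix_vector_mult_scaleR w_def mat_of_inner_commute)
    have "Y \<in> psd_cone"
      unfolding psd_cone_def
    proof safe
      fix v
      define r where "r = (a \<bullet> (mat_of X *v v)) / c"
      have va: "v \<bullet> (mat_of X *v a) = c * r"
        using c by (simp add: r_def inner_commute[of a] mat_of_inner_commute)
      have av: "a \<bullet> (mat_of X *v v) = c * r"
        using c by (simp add: r_def)
      have Yv: "mat_of Y *v v = mat_of X *v v - r *\<^sub>R (mat_of X *v a)"
        by (simp add: Y matrix_vector_mult_diff_distrib matrix_vector_mult_scaleR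
            flip: r_def)
      have "(v - r *\<^sub>R a) \<bullet> (mat_of X *v (v - r *\<^sub>R a))
          = v \<bullet> (mat_of X *v v) - r * (c * r)"
        by (simp add: inner_diff_left matrix_vector_mult_diff_distrib
            matrix_vector_mult_scaleR inner_diff_right av va flip: c_def)
      also have "\<dots> = v \<bullet> (mat_of Y *v v)"
        by (simp add: Yv inner_diff_right va)
      finally show "0 \<le> v \<bullet> (mat_of Y *v v)"
        using psd by metis
    qed
    have "mat_of Y *v a = 0"
      using c by (simp add: Y flip: c_def)
    moreover have "mat_of X *v a \<noteq> 0"
      using a by auto
    moreover have "mat_of Y *v v = 0" if "mat_of X *v v = 0" for v
      using that by (simp add: Y)
    ultimately have "{v. mat_of X *v v = 0} \<subset> {v. mat_of Y *v v = 0}"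
      by blast
    then have "dim {v. mat_of X *v v = 0} < dim {v. mat_of Y *v v = 0}"
      by (intro dim_psubset) (simp add: span_eq_iff[THEN iffD2, OF subspace_kernel_mat_of])
    then have "DIM(real^'p) - dim {v. mat_of Y *v v = 0} < DIM(real^'p) - dim {v. mat_of X *v v = 0}"
      using dim_subset_UNIV[of "{v. mat_of Y *v v = 0}"] by linarith
    then obtain vs where vs: "Y = (\<Sum>v\<leftarrow>vs. rank_one v)" "set vs \<subseteq> range ((*v) (mat_of Y))"
      using less.hyps \<open>Y \<in> psd_cone\<close> by metis
    have "X = (\<Sum>v\<leftarrow>w # vs. rank_one v)"
      by (simp add: Y_def flip: vs(1))
    moreover have "w = mat_of X *v ((1 / sqrt c) *\<^sub>R a)"
      by (simp add: w_def matrix_vector_mult_scaleR)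
    then have "set (w # vs) \<subseteq> range ((*v) (mat_of X))"
      using vs(2) Y by auto
    ultimately show ?thesis
      by (rule less.prems(1))
  qed
qed

text \<open>The form of \<open>D\<close> has to be nonnegative only on a subspace that contains the range of \<open>G\<close>, since
  \<open>G \<bullet> D\<close> is a sum of values of that form at vectors of the range. If the sum vanishes, each of
  these vectors is isotropic.\<close>

lemma psd_inner_form_on_subspace:
  assumes G: "G \<in> psd_cone" and V: "subspace V" "\<And>a. mat_of G *v a \<in> V"
    and D: "\<And>w. w \<in> V \<Longrightarrow> 0 \<le> w \<bullet> (mat_of D *v w)"
  shows psd_inner_nonneg_on_subspace: "0 \<le> G \<bullet> D"
    and psd_inner_zero_on_subspace:
      "G \<bullet> D = 0 \<Longrightarrow> w \<in> V \<Longrightarrow> w \<bullet> (mat_of D *v (mat_of G *v a)) = 0"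
proof -
  obtain vs where vs: "G = (\<Sum>v\<leftarrow>vs. rank_one v)" "set vs \<subseteq> range ((*v) (mat_of G))"
    using psd_cone_decomposition[OF G] .
  have vV: "v \<in> V" if "v \<in> set vs" for v
    using that vs(2) V(2) by auto
  have "D \<bullet> (\<Sum>v\<leftarrow>us. rank_one v) = (\<Sum>v\<leftarrow>us. v \<bullet> (mat_of D *v v))" for us
    by (induction us) (simp_all add: inner_add_right inner_rank_one)
  then have GD: "G \<bullet> D = (\<Sum>v\<leftarrow>vs. v \<bullet> (mat_of D *v v))"
    using vs(1) by (simp add: inner_commute)
  then show "0 \<le> G \<bullet> D"
    using vV D by (auto intro!: sum_list_nonneg)
  assume "G \<bullet> D = 0" and w: "w \<in> V"
  then have z0: "\<forall>r\<in>set (map (\<lambda>v. v \<bullet> (mat_of D *v v)) vs). r = 0"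
    using GD vV D
    by (intro sum_list_nonneg_eq_0_iff[THEN iffD1]) auto
  have z: "w \<bullet> (mat_of D *v v) = 0" if "v \<in> set vs" for v
  proof (rule form_null_on_subspace[OF V(1) D vV[OF that] _ w])
    show "v \<bullet> (mat_of D *v v) = 0"
      using that z0 by simp
  qed
  have "set us \<subseteq> set vs \<Longrightarrow> w \<bullet> (mat_of D *v (mat_of (\<Sum>v\<leftarrow>us. rank_one v) *v a)) = 0" for us
    by (induction us) (simp_all add: matrix_vector_mult_add_rdistrib matrix_vector_right_distrib
        inner_add_right rank_one_mult matrix_vector_mult_scaleR z)
  then show "w \<bullet> (mat_of D *v (mat_of G *v a)) = 0"
    using vs(1) by blast
qed

lemma psd_inner_nonneg: "G \<in> psd_cone \<Longrightarrow> D \<in> psd_cone \<Longrightarrow> 0 \<le> G \<bullet> D"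
  using psd_inner_nonneg_on_subspace[of G UNIV D] by (simp add: psd_cone_def)

lemma psd_inner_zero_mult:
  assumes "G \<in> psd_cone" "D \<in> psd_cone" "G \<bullet> D = 0"
  shows "mat_of D *v (mat_of G *v a) = 0"
  using psd_inner_zero_on_subspace[of G UNIV D "mat_of D *v (mat_of G *v a)" a] assms
  by (simp add: psd_cone_def)

text \<open>Testing against \<open>0\<close> and \<open>2 X\<close> gives complementarity; the rank-one matrices then give
  semidefiniteness.\<close>

lemma normal_cone_psd_cone_iff:
  assumes X: "X \<in> psd_cone"
  shows "- G \<in> normal_cone psd_cone X \<longleftrightarrow> G \<in> psd_cone \<and> G \<bullet> X = 0"
proof
  assume "- G \<in> normal_cone psd_cone X"
  then have G: "G \<bullet> (Y - X) \<ge> 0" if "Y \<in> psd_cone" for Y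
    using that by (auto simp: normal_cone_def)
  have "X + X \<in> psd_cone"
    using X by (simp only: psd_cone_def mem_Collect_eq mat_of_add
        matrix_vector_mult_add_rdistrib inner_add_right) auto
  then have "G \<bullet> X = 0"
    using G[OF zero_in_psd_cone] G[of "X + X"] by simp
  moreover have "0 \<le> v \<bullet> (mat_of G *v v)" for v
    using G[OF rank_one_in_psd_cone, of v] \<open>G \<bullet> X = 0\<close>
    by (simp add: inner_diff_right inner_rank_one)
  ultimately show "G \<in> psd_cone \<and> G \<bullet> X = 0"
    by (simp add: psd_cone_def)
next
  assume "G \<in> psd_cone \<and> G \<bullet> X = 0"
  then show "- G \<in> normal_cone psd_cone X"
    using X by (auto simp: normal_cone_def inner_diff_right psd_inner_nonneg)
qed

text \<open>The polar of the normal cone: normals at \<open>X\<close> are the matrices \<open>- G\<close> with \<open>G\<close> positive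
  semidefinite and range inside the kernel of \<open>X\<close>, so only the form of \<open>D\<close> on that kernel matters.\<close>

lemma tangent_cone_psd_cone_iff:
  assumes X: "X \<in> psd_cone"
  shows "D \<in> tangent_cone psd_cone X \<longleftrightarrow> (\<forall>v. mat_of X *v v = 0 \<longrightarrow> 0 \<le> v \<bullet> (mat_of D *v v))"
proof
  assume D: "D \<in> tangent_cone psd_cone X"
  show "\<forall>v. mat_of X *v v = 0 \<longrightarrow> 0 \<le> v \<bullet> (mat_of D *v v)"
  proof (intro allI impI)
    fix v assume "mat_of X *v v = 0"
    then have "- rank_one v \<in> normal_cone psd_cone X"
      using normal_cone_psd_cone_iff[OF X] rank_one_in_psd_cone
      by (metis inner_commute inner_rank_one inner_zero_right)
    from tangent_cone_imp_normal_cone_le[OF D this] show "0 \<le> v \<bullet> (mat_of D *v v)"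
      by (simp add: inner_commute[of _ D] inner_rank_one)
  qed
next
  assume D: "\<forall>v. mat_of X *v v = 0 \<longrightarrow> 0 \<le> v \<bullet> (mat_of D *v v)"
  have "V \<bullet> D \<le> 0" if "V \<in> normal_cone psd_cone X" for V
  proof -
    have V: "- V \<in> psd_cone" "- V \<bullet> X = 0"
      using that normal_cone_psd_cone_iff[OF X, of "- V"] by auto
    have "0 \<le> - V \<bullet> D"
      using D psd_inner_zero_mult[OF V(1) X V(2)]
      by (intro psd_inner_nonneg_on_subspace[OF V(1) subspace_kernel_mat_of[of X]]) auto
    then show ?thesis by simp
  qed
  then show "D \<in> tangent_cone psd_cone X"
    by (simp add: tangent_cone_convex_iff[OF convex_psd_cone X])
qed

lemma psd_mult_eq_zero:
  assumes "X \<in> psd_cone" "v \<bullet> (mat_of X *v v) = 0"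
  shows "mat_of X *v v = 0"
proof -
  have "(mat_of X *v v) \<bullet> (mat_of X *v v) = 0"
    by (rule form_null_on_subspace[OF subspace_UNIV]) (use assms in \<open>auto simp: psd_cone_def\<close>)
  then show ?thesis
    by simp
qed

lemma symmetric_vanishing_product:
  assumes "\<And>v. mat_of E *v (mat_of S *v v) = 0"
  shows "mat_of S *v (mat_of E *v v) = 0"
proof -
  have "(mat_of S *v (mat_of E *v v)) \<bullet> w = 0" for w
    using assms[of w] by (simp add: mat_of_inner_commute)
  then show ?thesis
    by (metis inner_eq_zero_iff)
qed

section \<open>The dual of the tangent cone intersected with a complementary hyperplane\<close>

text \<open>The transpose of the pseudo-inverse satisfies the Penrose equations of the transposed matrix, so
  by uniqueness the pseudo-inverse of a symmetric matrix is symmetric and commutes with it. Hence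
  \<open>X X\<^sup>\<dagger>\<close> is the orthogonal projection onto the range of \<open>X\<close>.\<close>

lemma pseudo_inverse_mat_of:
  fixes x :: "('p::finite) symmat"
  defines "X \<equiv> mat_of x" and "Y \<equiv> pseudo_inverse (mat_of x)"
  shows transpose_pseudo_inverse_mat_of: "transpose Y = Y"
    and pseudo_inverse_mat_of_commute: "Y ** X = X ** Y"
    and pseudo_inverse_mat_of_inner: "X ** Y ** X = X" "Y ** X ** Y = Y"
proof -
  have XY: "is_pseudo_inverse X Y"
    unfolding X_def Y_def by (rule is_pseudo_inverse_pseudo_inverse)
  then have XYX: "X ** Y ** X = X" and YXY: "Y ** X ** Y = Y"
    and tXY: "transpose (X ** Y) = X ** Y" and tYX: "transpose (Y ** X) = Y ** X"
    unfolding is_pseudo_inverse_def by blast+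
  have X: "transpose X = X"
    by (simp add: X_def)
  have XtY: "X ** transpose Y = Y ** X"
    using tYX by (simp only: matrix_transpose_mul X)
  have tYX': "transpose Y ** X = X ** Y"
    using tXY by (simp only: matrix_transpose_mul X)
  have "X ** transpose Y ** X = transpose (X ** Y ** X)"
    by (simp only: matrix_transpose_mul X matrix_mul_assoc)
  also have "\<dots> = X"
    by (simp only: XYX X)
  finally have 1: "X ** transpose Y ** X = X" .
  have "transpose Y ** X ** transpose Y = transpose (Y ** X ** Y)"
    by (simp only: matrix_transpose_mul X matrix_mul_assoc)
  also have "\<dots> = transpose Y"
    by (simp only: YXY)
  finally have 2: "transpose Y ** X ** transpose Y = transpose Y" .
  have 3: "transpose (X ** transpose Y) = X ** transpose Y"
    by (simp only: XtY tYX)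
  have 4: "transpose (transpose Y ** X) = transpose Y ** X"
    by (simp only: tYX' tXY)
  have "is_pseudo_inverse X (transpose Y)"
    unfolding is_pseudo_inverse_def by (intro conjI 1 2 3 4)
  then show t: "transpose Y = Y"
    using XY is_pseudo_inverse_unique by blast
  show "Y ** X = X ** Y"
    using XtY by (simp only: t)
  show "X ** Y ** X = X" "Y ** X ** Y = Y"
    by (fact XYX, fact YXY)
qed

lemma matrix_mult_diff_ldistrib: "A ** (B - C) = A ** B - (A ** C :: real^'k^'m)"
  for A :: "real^'n^'m"
  by (simp add: matrix_eq matrix_vector_mult_diff_rdistrib matrix_vector_mult_diff_distrib
      flip: matrix_vector_mul_assoc)

lemma matrix_mult_diff_rdistrib: "(A - B) ** C = A ** C - (B ** C :: real^'k^'m)"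
  for A :: "real^'n^'m"
  by (simp add: matrix_eq matrix_vector_mult_diff_rdistrib flip: matrix_vector_mul_assoc)

text \<open>Since \<open>x \<bullet> d = 0\<close> and the form of \<open>d\<close> is nonnegative on the kernel of \<open>s\<close>, which contains the
  range of \<open>x\<close>, the matrix \<open>d\<close> maps the range of \<open>x\<close> into the orthogonal complement of that kernel,
  that is, into the range of \<open>s\<close>, where \<open>e\<close> vanishes. So \<open>e d x = 0\<close>, and the inner product does not
  change if \<open>e\<close> is replaced by \<open>R e R\<close> with \<open>R\<close> the projection onto the kernel of \<open>x\<close>. That matrix is
  positive semidefinite with range in the kernel of \<open>s\<close>.\<close>

lemma inner_nonneg_tangent_cone_perp:
  fixes s x e d :: "('p::finite) symmat"
  assumes s: "s \<in> psd_cone" and x: "x \<in> psd_cone" and sx: "s \<bullet> x = 0"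
    and e: "e \<in> tangent_cone psd_cone x" and es: "\<And>v. mat_of e *v (mat_of s *v v) = 0"
    and d: "d \<in> tangent_cone psd_cone s \<inter> {x}\<^sup>\<bottom>"
  shows "0 \<le> e \<bullet> d"
proof -
  define X D E S where "X = mat_of x" "D = mat_of d" "E = mat_of e" "S = mat_of s"
  define Y where "Y = pseudo_inverse X"
  note Y = pseudo_inverse_mat_of[of x, folded X_D_E_S_def, folded Y_def]
  have sym: "transpose X = X" "transpose D = D" "transpose E = E" "transpose S = S"
    by (simp_all add: X_D_E_S_def)
  have SX: "S *v (X *v v) = 0" for v
    using psd_inner_zero_mult[OF x s] sx by (simp add: X_D_E_S_def inner_commute)
  have SE: "S *v (E *v v) = 0" for v
    using symmetric_vanishing_product[of e s] es by (simp add: X_D_E_S_def)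
  have dX: "w \<bullet> (D *v (X *v a)) = 0" if "S *v w = 0" for w a
    unfolding X_D_E_S_def
  proof (rule psd_inner_zero_on_subspace[OF x subspace_kernel_mat_of[of s]])
    show "mat_of x *v a \<in> {v. mat_of s *v v = 0}" for a
      using SX by (simp add: X_D_E_S_def)
    show "0 \<le> w \<bullet> (mat_of d *v w)" if "w \<in> {v. mat_of s *v v = 0}" for w
      using that d tangent_cone_psd_cone_iff[OF s] by simp
    show "x \<bullet> d = 0"
      using d by (simp add: orthogonal_comp_def orthogonal_def)
    show "w \<in> {v. mat_of s *v v = 0}"
      using that by (simp add: X_D_E_S_def)
  qed
  have zeroI: "M = 0" if "\<And>v w. w \<bullet> (M *v v) = 0" for M :: "real^'p^'p"
    using that by (subst matrix_eq) (metis inner_eq_zero_iff matrix_vector_mult_0)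
  have EDX: "E ** D ** X = 0"
  proof (rule zeroI)
    fix v w
    have "(E *v w) \<bullet> (D *v (X *v v)) = 0"
      by (rule dX[OF SE])
    then show "w \<bullet> (E ** D ** X *v v) = 0"
      by (simp add: X_D_E_S_def mat_of_inner_commute flip: matrix_vector_mul_assoc)
  qed
  have XDX: "X ** D ** X = 0"
  proof (rule zeroI)
    fix v w
    have "(X *v w) \<bullet> (D *v (X *v v)) = 0"
      by (rule dX[OF SX])
    then show "w \<bullet> (X ** D ** X *v v) = 0"
      by (simp add: X_D_E_S_def mat_of_inner_commute flip: matrix_vector_mul_assoc)
  qed
  define P where "P = X ** Y"
  define R where "R = mat 1 - P"
  have P: "transpose P = P" "P = Y ** X"
    using Y by (simp_all add: P_def matrix_transpose_mul sym)
  have "P $ i $ j = P $ j $ i" for i j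
    using arg_cong[OF P(1), of "\<lambda>M. M $ j $ i"] by (simp add: transpose_def)
  then have R: "transpose R = R"
    by (simp add: R_def transpose_def vec_eq_iff mat_def)
  define g where "g = Symmat (R ** E ** R)"
  have g: "mat_of g = R ** E ** R"
    unfolding g_def
    by (rule Symmat_inverse) (simp add: matrix_transpose_mul R sym matrix_mul_assoc)
  have Rc: "(R *v a) \<bullet> b = a \<bullet> (R *v b)" for a b
    by (rule symmetric_matrix_inner[OF R])
  have gform: "w \<bullet> (mat_of g *v w) = (R *v w) \<bullet> (E *v (R *v w))" for w
    by (simp add: g Rc flip: matrix_vector_mul_assoc)
  have "X ** R = 0"
    by (simp add: R_def matrix_mult_diff_ldistrib P(2) matrix_mul_assoc Y(3))
  then have XR: "X *v (R *v w) = 0" for w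
    by (simp add: matrix_vector_mul_assoc)
  have "S ** P = 0"
    by (rule zeroI) (simp add: P_def SX flip: matrix_vector_mul_assoc)
  then have "S ** R = S"
    by (simp add: R_def matrix_mult_diff_ldistrib)
  then have SR: "S *v (R *v w) = S *v w" for w
    by (simp add: matrix_vector_mul_assoc)
  have "g \<in> psd_cone"
    using XR e tangent_cone_psd_cone_iff[OF x] by (simp add: psd_cone_def gform X_D_E_S_def)
  then have "0 \<le> g \<bullet> d"
  proof (rule psd_inner_nonneg_on_subspace[OF _ subspace_kernel_mat_of[of s]])
    show "mat_of g *v a \<in> {v. mat_of s *v v = 0}" for a
      using SR SE by (simp add: g X_D_E_S_def flip: matrix_vector_mul_assoc)
    show "0 \<le> w \<bullet> (mat_of d *v w)" if "w \<in> {v. mat_of s *v v = 0}" for w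
      using that d tangent_cone_psd_cone_iff[OF s] by simp
  qed
  also have "g \<bullet> d = trace (R ** E ** R ** D)"
    by (simp add: inner_symmat_def g X_D_E_S_def)
  also have "\<dots> = trace (R ** (E ** R ** D))"
    by (simp add: matrix_mul_assoc)
  also have "\<dots> = trace (E ** (R ** D ** R))"
    by (subst trace_mul_sym) (simp add: matrix_mul_assoc)
  also have "\<dots> = trace (E ** D)"
  proof -
    have trace_zero: "trace (0 :: real^'p^'p) = 0"
      by (simp add: trace_def)
    have EDP: "E ** D ** P = 0"
      by (simp add: P_def EDX matrix_mul_assoc)
    have "P ** D ** E = transpose (E ** D ** P)"
      by (simp add: matrix_transpose_mul sym P(1) matrix_mul_assoc)
    then have PDE: "P ** D ** E = 0"
      by (simp add: EDP transpose_def vec_eq_iff)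
    have "P ** D ** P = Y ** (X ** D ** X) ** Y"
      by (subst P(2), simp add: P_def matrix_mul_assoc)
    then have PDP: "P ** D ** P = 0"
      by (simp add: XDX)
    have "R ** D ** R = D - P ** D - D ** P"
      by (simp add: R_def matrix_mult_diff_ldistrib matrix_mult_diff_rdistrib PDP)
    then have "trace (E ** (R ** D ** R)) = trace (E ** D) - trace (E ** (P ** D))"
      by (simp add: matrix_mult_diff_ldistrib trace_sub matrix_mul_assoc EDP trace_zero)
    also have "trace (E ** (P ** D)) = trace (P ** D ** E)"
      by (rule trace_mul_sym)
    finally show ?thesis
      by (simp add: PDE trace_zero)
  qed
  also have "\<dots> = e \<bullet> d"
    by (simp add: inner_symmat_def X_D_E_S_def)
  finally show ?thesis .
qed

text \<open>The test directions are \<open>w w\<^sup>T\<close> with \<open>w\<close> in the kernel of \<open>x\<close>, and the symmetric products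
  of vectors in the range of \<open>s\<close> with arbitrary vectors. The form of a product of the second kind
  vanishes on the kernel of \<open>s\<close>, so both signs are allowed and \<open>e s = 0\<close> is forced. This covers the
  block of \<open>e\<close> between the ranges of \<open>s\<close> and \<open>x\<close>, about which \<open>s \<bullet> e = 0\<close> says nothing.\<close>

lemma tangent_cone_perp_dual_necessary:
  assumes s: "s \<in> psd_cone" and x: "x \<in> psd_cone" and sx: "s \<bullet> x = 0"
    and e: "\<And>d. d \<in> tangent_cone psd_cone s \<inter> {x}\<^sup>\<bottom> \<Longrightarrow> 0 \<le> e \<bullet> d"
  shows "e \<in> tangent_cone psd_cone x" "mat_of e *v (mat_of s *v v) = 0"
proof -
  have K: "d \<in> tangent_cone psd_cone s \<inter> {x}\<^sup>\<bottom>"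
    if "\<And>w. mat_of s *v w = 0 \<Longrightarrow> 0 \<le> w \<bullet> (mat_of d *v w)" "x \<bullet> d = 0" for d
    using that tangent_cone_psd_cone_iff[OF s] by (simp add: orthogonal_comp_def orthogonal_def)
  show "e \<in> tangent_cone psd_cone x"
    unfolding tangent_cone_psd_cone_iff[OF x]
  proof (intro allI impI)
    fix w assume "mat_of x *v w = 0"
    then have "rank_one w \<in> tangent_cone psd_cone s \<inter> {x}\<^sup>\<bottom>"
      by (intro K) (simp_all add: inner_rank_one rank_one_mult inner_commute)
    from e[OF this] show "0 \<le> w \<bullet> (mat_of e *v w)"
      by (simp add: inner_rank_one)
  qed
  define q where "q = mat_of e *v (mat_of s *v v)"
  have xs: "mat_of x *v (mat_of s *v v) = 0"
    by (rule psd_inner_zero_mult[OF s x sx])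
  have "sym_product (mat_of s *v v) (- q) \<in> tangent_cone psd_cone s \<inter> {x}\<^sup>\<bottom>"
  proof (rule K)
    show "x \<bullet> sym_product (mat_of s *v v) (- q) = 0"
      using xs by (simp add: inner_sym_product flip: mat_of_inner_commute)
    show "0 \<le> w \<bullet> (mat_of (sym_product (mat_of s *v v) (- q)) *v w)" if "mat_of s *v w = 0" for w
    proof -
      have "w \<bullet> (mat_of s *v v) = 0"
        using that by (simp flip: mat_of_inner_commute)
      then show ?thesis
        by (simp add: sym_product_mult inner_diff_right inner_commute[of _ w])
    qed
  qed
  from e[OF this] have "q \<bullet> q \<le> 0"
    by (simp add: inner_sym_product q_def flip: mat_of_inner_commute)
  then show "mat_of e *v (mat_of s *v v) = 0"
    unfolding q_def by (metis inner_eq_zero_iff inner_ge_zero order_antisym)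
qed

section \<open>Vanishing of the curvature term\<close>

text \<open>The identity \<open>x\<^sup>\<dagger> = x\<^sup>\<dagger> x x\<^sup>\<dagger>\<close> exhibits \<open>n = d x\<^sup>\<dagger> d\<close> as positive semidefinite.\<close>

lemma sigma_term_eq_inner:
  fixes s x d :: "('p::finite) symmat"
  assumes x: "x \<in> psd_cone"
  defines "Y \<equiv> pseudo_inverse (mat_of x)"
  obtains n where "n \<in> psd_cone" "sigma_term s x d = s \<bullet> n"
    "\<And>v. v \<bullet> (mat_of n *v v)
      = (Y *v (mat_of d *v v)) \<bullet> (mat_of x *v (Y *v (mat_of d *v v)))"
proof -
  note Y = pseudo_inverse_mat_of[of x, folded Y_def]
  define n where "n = Symmat (mat_of d ** Y ** mat_of d)"
  have n: "mat_of n = mat_of d ** Y ** mat_of d"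
    unfolding n_def
    by (rule Symmat_inverse) (simp add: matrix_transpose_mul Y(1) matrix_mul_assoc)
  have nv: "mat_of n *v v = mat_of d *v (Y *v (mat_of d *v v))" for v
    by (simp add: n matrix_vector_mul_assoc matrix_mul_assoc)
  have Yc: "(Y *v a) \<bullet> b = a \<bullet> (Y *v b)" for a b
    by (rule symmetric_matrix_inner[OF Y(1)])
  have form: "v \<bullet> (mat_of n *v v)
      = (Y *v (mat_of d *v v)) \<bullet> (mat_of x *v (Y *v (mat_of d *v v)))" for v
  proof -
    have "Y *v (mat_of x *v (Y *v a)) = Y *v a" for a
      by (simp add: matrix_vector_mul_assoc matrix_mul_assoc Y(4))
    then show ?thesis
      by (simp add: nv Yc) (simp flip: mat_of_inner_commute)
  qed
  have "n \<in> psd_cone"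
    using x by (simp add: psd_cone_def form)
  moreover have "sigma_term s x d = s \<bullet> n"
    by (simp add: sigma_term_def inner_symmat_def n Y_def)
  ultimately show ?thesis
    using that form by blast
qed

lemma sigma_term_nonneg:
  assumes "s \<in> psd_cone" "x \<in> psd_cone"
  shows "0 \<le> sigma_term s x d"
  by (rule sigma_term_eq_inner[OF assms(2), of s d]) (simp add: psd_inner_nonneg[OF assms(1)])

lemma sigma_term_eq_zero_imp:
  assumes s: "s \<in> psd_cone" and x: "x \<in> psd_cone" and "sigma_term s x d = 0"
  shows "mat_of x *v (mat_of d *v (mat_of s *v v)) = 0"
proof -
  define Y where "Y = pseudo_inverse (mat_of x)"
  note Y = pseudo_inverse_mat_of[of x, folded Y_def]
  obtain n where n: "n \<in> psd_cone" "sigma_term s x d = s \<bullet> n"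
    "\<And>v. v \<bullet> (mat_of n *v v)
      = (Y *v (mat_of d *v v)) \<bullet> (mat_of x *v (Y *v (mat_of d *v v)))"
    unfolding Y_def by (rule sigma_term_eq_inner[OF x, of s d]) blast
  define a where "a = mat_of d *v (mat_of s *v v)"
  have "mat_of n *v (mat_of s *v v) = 0"
    using psd_inner_zero_mult[OF s n(1)] n(2) assms(3) by simp
  then have "(Y *v a) \<bullet> (mat_of x *v (Y *v a)) = 0"
    using n(3)[of "mat_of s *v v"] by (simp add: a_def)
  then have "mat_of x *v (Y *v a) = 0"
    by (rule psd_mult_eq_zero[OF x])
  then have "mat_of x *v (mat_of x *v (Y *v a)) = 0"
    by simp
  also have "mat_of x *v (mat_of x *v (Y *v a)) = (mat_of x ** (mat_of x ** Y)) *v a"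
    by (simp add: matrix_vector_mul_assoc matrix_mul_assoc)
  also have "mat_of x ** (mat_of x ** Y) = mat_of x ** Y ** mat_of x"
    by (subst Y(2)[symmetric]) (rule matrix_mul_assoc)
  also have "\<dots> = mat_of x"
    by (rule Y(3))
  finally show ?thesis
    by (simp add: a_def)
qed

text \<open>The curvature term vanishes exactly when \<open>x e s = 0\<close>, and that is the condition on the block of
  \<open>e\<close> between the ranges of \<open>s\<close> and \<open>x\<close>. On the kernel of \<open>x\<close>, where the form of \<open>e\<close> is
  nonnegative, \<open>s \<bullet> e = 0\<close> makes the vectors in the range of \<open>s\<close> isotropic. Together: \<open>e s v\<close> lies in
  the kernel of \<open>x\<close> and is orthogonal to it.\<close>

lemma sigma_term_zero_iff:
  assumes s: "s \<in> psd_cone" and x: "x \<in> psd_cone" and sx: "s \<bullet> x = 0"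
    and e: "e \<in> tangent_cone psd_cone x"
  shows "s \<bullet> e = 0 \<and> sigma_term s x e = 0 \<longleftrightarrow> (\<forall>v. mat_of e *v (mat_of s *v v) = 0)"
proof
  assume es: "\<forall>v. mat_of e *v (mat_of s *v v) = 0"
  have se: "mat_of s *v (mat_of e *v v) = 0" for v
    using symmetric_vanishing_product es by blast
  have "mat_of s ** mat_of e = 0"
    by (subst matrix_eq) (simp add: se flip: matrix_vector_mul_assoc)
  then show "s \<bullet> e = 0 \<and> sigma_term s x e = 0"
    by (simp add: inner_symmat_def sigma_term_def matrix_mul_assoc trace_def)
next
  assume A: "s \<bullet> e = 0 \<and> sigma_term s x e = 0"
  show "\<forall>v. mat_of e *v (mat_of s *v v) = 0"
  proof
    fix v
    have "(mat_of e *v (mat_of s *v v)) \<bullet> (mat_of e *v (mat_of s *v v)) = 0"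
    proof (rule psd_inner_zero_on_subspace[OF s subspace_kernel_mat_of[of x]])
      show "mat_of s *v a \<in> {v. mat_of x *v v = 0}" for a
        using psd_inner_zero_mult[OF s x sx] by simp
      show "0 \<le> w \<bullet> (mat_of e *v w)" if "w \<in> {v. mat_of x *v v = 0}" for w
        using that e tangent_cone_psd_cone_iff[OF x] by simp
      show "s \<bullet> e = 0"
        using A by simp
      show "mat_of e *v (mat_of s *v v) \<in> {v. mat_of x *v v = 0}"
        using sigma_term_eq_zero_imp[OF s x] A by simp
    qed
    then show "mat_of e *v (mat_of s *v v) = 0"
      by simp
  qed
qed

section \<open>Directional derivatives of the support function\<close>

lemma theta_at_normal:
  assumes "- z \<in> normal_cone P x"
  shows "theta P z = ereal (- z \<bullet> x)"
proof -
  have "x \<in> P" "\<And>p. p \<in> P \<Longrightarrow> - z \<bullet> p \<le> - z \<bullet> x"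
    using assms by (auto simp: normal_cone_def inner_diff_right)
  then show ?thesis
    unfolding theta_def support_function_def
    by (intro antisym SUP_least SUP_upper) auto
qed

lemma theta_ge: "p \<in> P \<Longrightarrow> ereal (- z \<bullet> p) \<le> theta P z"
  unfolding theta_def support_function_def by (rule SUP_upper)

lemma tendsto_at_right_mono:
  fixes f :: "real \<Rightarrow> 'a::{complete_linorder, linorder_topology}"
  assumes "\<And>s t. a < s \<Longrightarrow> s \<le> t \<Longrightarrow> f s \<le> f t"
  shows "(f \<longlongrightarrow> (INF t\<in>{a<..}. f t)) (at_right a)"
proof (rule order_tendstoI)
  fix b assume "b < (INF t\<in>{a<..}. f t)"
  then have "b < f t" if "a < t" for t
    using that by (meson INF_lower greaterThan_iff less_le_trans)
  then show "eventually (\<lambda>t. b < f t) (at_right a)"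
    using eventually_at_right_less[of a] by (rule eventually_mono[rotated])
next
  fix b assume "(INF t\<in>{a<..}. f t) < b"
  then obtain t where "a < t" "f t < b"
    by (auto simp: INF_less_iff)
  then show "eventually (\<lambda>s. f s < b) (at_right a)"
    unfolding eventually_at_right_field using assms by (meson le_less_trans less_imp_le)
qed

text \<open>Divided by the step \<open>\<tau>\<close>, the contribution of a point \<open>p\<close> of \<open>P\<close> to the quotient is
  \<open>(z \<bullet> x - z \<bullet> p) / \<tau> - u \<bullet> p\<close>, and the numerator is not positive because \<open>- z\<close> is normal at \<open>x\<close>.\<close>

lemma theta_quotient_mono:
  assumes z: "- z \<in> normal_cone P x" and "0 < \<sigma>" "\<sigma> \<le> \<tau>"
  shows "(theta P (z + \<sigma> *\<^sub>R u) - theta P z) / ereal \<sigma>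
    \<le> (theta P (z + \<tau> *\<^sub>R u) - theta P z) / ereal \<tau>"
proof -
  have x: "x \<in> P" and zp: "\<And>p. p \<in> P \<Longrightarrow> z \<bullet> x \<le> z \<bullet> p"
    using z by (auto simp: normal_cone_def inner_diff_right)
  note tz = theta_at_normal[OF z]
  show ?thesis
  proof (cases "theta P (z + \<tau> *\<^sub>R u)")
    case (real T)
    have "theta P (z + \<sigma> *\<^sub>R u) \<le> ereal (\<sigma> / \<tau> * (T + z \<bullet> x) - z \<bullet> x)"
      unfolding theta_def support_function_def
    proof (rule SUP_least)
      fix p assume p: "p \<in> P"
      have "- (z + \<tau> *\<^sub>R u) \<bullet> p \<le> T"
        using theta_ge[OF p, of "z + \<tau> *\<^sub>R u"] real by simp
      then have "\<sigma> / \<tau> * (- (z + \<tau> *\<^sub>R u) \<bullet> p + z \<bullet> x) \<le> \<sigma> / \<tau> * (T + z \<bullet> x)"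
        using assms(2,3) by (intro mult_left_mono) auto
      moreover have "z \<bullet> x - z \<bullet> p \<le> \<sigma> / \<tau> * (z \<bullet> x - z \<bullet> p)"
        using zp[OF p] assms(2,3) mult_right_mono_neg[of "\<sigma> / \<tau>" 1 "z \<bullet> x - z \<bullet> p"] by simp
      moreover have "\<sigma> / \<tau> * (- (z + \<tau> *\<^sub>R u) \<bullet> p + z \<bullet> x)
          = \<sigma> / \<tau> * (z \<bullet> x - z \<bullet> p) - \<sigma> * (u \<bullet> p)"
        using assms(2,3) by (simp add: inner_add_left inner_diff_left field_simps)
      ultimately show "ereal (- (z + \<sigma> *\<^sub>R u) \<bullet> p) \<le> ereal (\<sigma> / \<tau> * (T + z \<bullet> x) - z \<bullet> x)"
        by (simp add: inner_add_left inner_diff_left)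
    qed
    moreover obtain T' where T': "theta P (z + \<sigma> *\<^sub>R u) = ereal T'"
      using calculation theta_ge[OF x, of "z + \<sigma> *\<^sub>R u"] by (cases "theta P (z + \<sigma> *\<^sub>R u)") auto
    ultimately have "T' + z \<bullet> x \<le> \<sigma> / \<tau> * (T + z \<bullet> x)"
      by simp
    then have "(T' + z \<bullet> x) / \<sigma> \<le> (T + z \<bullet> x) / \<tau>"
      using assms(2,3) by (simp add: field_simps)
    then show ?thesis
      using assms(2,3) by (simp add: tz real T')
  next
    case PInf
    then show ?thesis
      using assms(2,3) by (simp add: tz)
  next
    case MInf
    then show ?thesis
      using theta_ge[OF x, of "z + \<tau> *\<^sub>R u"] by simp
  qed
qed

text \<open>The directional derivative is defined by a limit operator that says nothing unless the limit
  exists; monotonicity of the quotients in the extended reals provides the limit.\<close>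

lemma directional_derivative_theta_tendsto:
  assumes "- z \<in> normal_cone P x"
  shows "((\<lambda>t. (theta P (z + t *\<^sub>R u) - theta P z) / ereal t)
    \<longlongrightarrow> directional_derivative (theta P) z u) (at_right 0)"
proof -
  define f where "f = (\<lambda>t. (theta P (z + t *\<^sub>R u) - theta P z) / ereal t)"
  have "(f \<longlongrightarrow> (INF t\<in>{0<..}. f t)) (at_right 0)"
    by (rule tendsto_at_right_mono) (simp add: f_def theta_quotient_mono[OF assms])
  moreover from this have "Lim (at_right 0) f = (INF t\<in>{0<..}. f t)"
    by (intro tendsto_Lim) simp_all
  ultimately show ?thesis
    by (simp add: directional_derivative_def f_def)
qed

text \<open>For short steps \<open>t\<close> the point \<open>- (z + t (r z - n)) = (1 + t r) (- z) + t n\<close> is still normal at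
  \<open>x\<close>, so that \<open>theta\<close> is linear along the step.\<close>

lemma S_set_contains:
  assumes z: "- z \<in> normal_cone P x" and n: "n \<in> normal_cone P x"
  shows "r *\<^sub>R z - n \<in> S_set P x z"
proof -
  define u where "u = r *\<^sub>R z - n"
  have "((\<lambda>t. 1 + t * r) \<longlongrightarrow> 1 + 0 * r) (at_right 0)"
    by (intro tendsto_intros)
  then have "eventually (\<lambda>t. 0 < 1 + t * r) (at_right 0)"
    by (rule order_tendstoD) simp
  then have "eventually (\<lambda>t. (theta P (z + t *\<^sub>R u) - theta P z) / ereal t = ereal (- u \<bullet> x))
      (at_right 0)"
    using eventually_at_right_less[of "0::real"]
  proof eventually_elim
    case (elim t)
    have "- (z + t *\<^sub>R u) \<in> normal_cone P x"
      unfolding normal_cone_def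
    proof safe
      show "x \<in> P"
        using z by (simp add: normal_cone_def)
      fix p assume "p \<in> P"
      then have "- z \<bullet> (p - x) \<le> 0" "n \<bullet> (p - x) \<le> 0"
        using z n by (auto simp: normal_cone_def)
      then have "(1 + t * r) * (- z \<bullet> (p - x)) + t * (n \<bullet> (p - x)) \<le> 0"
        using elim by (intro add_nonpos_nonpos mult_nonneg_nonpos) auto
      also have "(1 + t * r) * (- z \<bullet> (p - x)) + t * (n \<bullet> (p - x)) = - (z + t *\<^sub>R u) \<bullet> (p - x)"
        by (simp add: u_def inner_add_left inner_diff_left algebra_simps)
      finally show "- (z + t *\<^sub>R u) \<bullet> (p - x) \<le> 0" .
    qed
    then show ?case
      using elim by (simp add: theta_at_normal[OF z] theta_at_normal inner_add_left inner_diff_left)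
  qed
  then have "directional_derivative (theta P) z u = ereal (- u \<bullet> x)"
    unfolding directional_derivative_def
    by (intro tendsto_Lim[OF trivial_limit_at_right_real] tendsto_eventually)
  then show ?thesis
    by (simp add: S_set_def flip: u_def)
qed

text \<open>Some point \<open>x + t d\<close> belongs to \<open>P\<close> and attains the support function at \<open>- z\<close> as \<open>x\<close> does. Hence
  all difference quotients in direction \<open>u\<close> are at least \<open>- u \<bullet> (x + t d)\<close>, whereas their limit is
  \<open>- u \<bullet> x\<close>.\<close>

lemma S_set_inner_nonneg:
  assumes P: "polyhedron P" and z: "- z \<in> normal_cone P x"
    and u: "u \<in> S_set P x z" and d: "d \<in> tangent_cone P x" and zd: "z \<bullet> d = 0"
  shows "0 \<le> u \<bullet> d"
proof -
  obtain t where t: "0 < t" "x + t *\<^sub>R d \<in> P"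
    using polyhedron_tangent_cone_feasible[OF P d] .
  have "ereal (- u \<bullet> (x + t *\<^sub>R d)) \<le> directional_derivative (theta P) z u"
  proof (rule tendsto_lowerbound[OF directional_derivative_theta_tendsto[OF z]])
    show "eventually (\<lambda>\<tau>. ereal (- u \<bullet> (x + t *\<^sub>R d))
        \<le> (theta P (z + \<tau> *\<^sub>R u) - theta P z) / ereal \<tau>) (at_right 0)"
      using eventually_at_right_less[of "0::real"]
    proof eventually_elim
      case (elim \<tau>)
      have "ereal (- z \<bullet> x - \<tau> * (u \<bullet> (x + t *\<^sub>R d))) \<le> theta P (z + \<tau> *\<^sub>R u)"
        using theta_ge[OF t(2), of "z + \<tau> *\<^sub>R u"] zd
        by (simp add: inner_add_left inner_diff_left inner_add_right algebra_simps)
      then show ?case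
        using elim by (cases "theta P (z + \<tau> *\<^sub>R u)")
          (auto simp: theta_at_normal[OF z] field_simps)
    qed
  qed simp
  moreover have "ereal (u \<bullet> x) + directional_derivative (theta P) z u = 0"
    using u by (simp add: S_set_def)
  ultimately have "- (u \<bullet> (x + t *\<^sub>R d)) \<le> - (u \<bullet> x)"
    by (cases "directional_derivative (theta P) z u") auto
  then show ?thesis
    using t(1) by (simp add: inner_add_right mult_le_0_iff zero_le_mult_iff)
qed

section \<open>Equivalence of the two conditions\<close>

lemma nonneg_if_multiples_bounded_below:
  fixes a \<beta> :: real
  assumes "\<And>t. 0 < t \<Longrightarrow> \<beta> \<le> t * a"
  shows "0 \<le> a"
proof (rule ccontr)
  assume "\<not> 0 \<le> a"
  moreover from this have "\<beta> \<le> (\<bar>\<beta>\<bar> + 1) / - a * a"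
    by (intro assms) (simp add: divide_pos_neg)
  ultimately show False
    by simp
qed

text \<open>The summand contains a cone in each of the relevant directions: multiples of
  elements of the first set, negative normals to \<open>P\<close>, and the line spanned by \<open>z\<close>. A linear
  functional bounded below on a cone is nonnegative on it. The tangent cone of \<open>P\<close> is recovered as the
  polar of the normal cone.\<close>

lemma bounded_below_on_summand:
  assumes s: "s \<in> psd_cone" and x: "x \<in> psd_cone" and sx: "s \<bullet> x = 0"
    and P: "convex P" and z: "- z \<in> normal_cone P x"
    and e: "\<And>g. g \<in> tangent_cone psd_cone s \<inter> {x}\<^sup>\<bottom> + S_set P x z \<Longrightarrow> \<beta> \<le> e \<bullet> g"
  shows "e \<in> tangent_cone psd_cone x" "mat_of e *v (mat_of s *v v) = 0"
    "e \<in> tangent_cone P x" "z \<bullet> e = 0"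
proof -
  define K where "K = tangent_cone psd_cone s \<inter> {x}\<^sup>\<bottom>"
  have xP: "x \<in> P"
    using z by (simp add: normal_cone_def)
  have S: "r *\<^sub>R z - t *\<^sub>R n \<in> S_set P x z" if "0 < t" "n \<in> normal_cone P x" for r t n
    using that by (intro S_set_contains[OF z]) (auto simp: normal_cone_def mult_le_0_iff)
  have 0: "0 \<in> normal_cone P x"
    using xP by (simp add: normal_cone_def)
  have S0: "0 \<in> S_set P x z"
    using S[of 1 0 0] 0 by simp
  have K0: "0 \<in> K"
    by (simp add: K_def tangent_cone_psd_cone_iff[OF s] orthogonal_comp_def orthogonal_def)
  have Kcone: "t *\<^sub>R d \<in> K" if "0 < t" "d \<in> K" for t d
    using that tangent_cone_scaleR[OF convex_psd_cone, of d s t]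
    by (auto simp: K_def orthogonal_comp_def orthogonal_def)
  have eK: "\<beta> \<le> e \<bullet> d" if "d \<in> K" for d
    using e[of "d + 0"] set_plus_intro[OF that S0] by (simp add: K_def)
  have eS: "\<beta> \<le> e \<bullet> u" if "u \<in> S_set P x z" for u
    using e[of "0 + u"] set_plus_intro[OF K0 that] by (simp add: K_def)
  have "0 \<le> e \<bullet> d" if "d \<in> K" for d
    using eK[OF Kcone[OF _ that]] by (intro nonneg_if_multiples_bounded_below[of \<beta>]) simp
  then show "e \<in> tangent_cone psd_cone x" "mat_of e *v (mat_of s *v v) = 0"
    using tangent_cone_perp_dual_necessary[OF s x sx] unfolding K_def by blast+
  have "n \<bullet> e \<le> 0" if "n \<in> normal_cone P x" for n
  proof -
    have "0 \<le> e \<bullet> - n"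
      using eS[OF S[OF _ that, of _ 0]]
      by (intro nonneg_if_multiples_bounded_below[of \<beta>]) simp
    then show ?thesis
      by (simp add: inner_commute)
  qed
  then show "e \<in> tangent_cone P x"
    by (simp add: tangent_cone_convex_iff[OF P xP])
  have ez: "\<beta> \<le> r * (e \<bullet> z)" for r
    using eS[OF S[OF zero_less_one 0, of r]] by simp
  have "0 \<le> e \<bullet> z"
    using ez by (rule nonneg_if_multiples_bounded_below)
  moreover have "0 \<le> - (e \<bullet> z)"
    using ez[of "- _"] by (intro nonneg_if_multiples_bounded_below[of \<beta>]) simp
  ultimately show "z \<bullet> e = 0"
    by (simp add: inner_commute)
qed

text \<open>In finite dimension a point outside a convex set, closed or not, can be weakly separated from it,
  and the separating functional is bounded below on the set.\<close>

lemma convex_eq_UNIV_iff_unbounded: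
  fixes C :: "'a::euclidean_space set"
  assumes "convex C"
  shows "C = UNIV \<longleftrightarrow> (\<forall>e \<beta>. (\<forall>g\<in>C. \<beta> \<le> e \<bullet> g) \<longrightarrow> e = 0)"
proof
  assume "C = UNIV"
  then show "\<forall>e \<beta>. (\<forall>g\<in>C. \<beta> \<le> e \<bullet> g) \<longrightarrow> e = 0"
  proof (intro allI impI)
    fix e \<beta> assume "C = UNIV" "\<forall>g\<in>C. \<beta> \<le> e \<bullet> g"
    then have "\<beta> \<le> t * - (e \<bullet> e)" for t
      by (metis UNIV_I inner_scaleR_right inner_minus_right)
    then have "0 \<le> - (e \<bullet> e)"
      by (rule nonneg_if_multiples_bounded_below)
    then show "e = 0"
      by (metis inner_eq_zero_iff inner_ge_zero neg_0_le_iff_le order_antisym)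
  qed
next
  assume A: "\<forall>e \<beta>. (\<forall>g\<in>C. \<beta> \<le> e \<bullet> g) \<longrightarrow> e = 0"
  show "C = UNIV"
  proof (rule ccontr)
    assume "C \<noteq> UNIV"
    then obtain p where p: "p \<notin> C"
      by blast
    have "C \<noteq> {}"
      using A nonzero_Basis SOME_Basis by (metis empty_iff)
    then obtain a b where "a \<noteq> 0" "\<forall>g\<in>C. b \<le> a \<bullet> g"
      using separating_hyperplane_sets[of "{p}" C] assms p by auto
    then show False
      using A by blast
  qed
qed

lemma multipliersD:
  assumes "(s, y, z, v) \<in> multipliers Q c A b P x u" and x: "x \<in> psd_cone"
  shows "s \<in> psd_cone" "s \<bullet> x = 0" "- z \<in> normal_cone P x" "Q x + c = adjoint A y + z + s"
proof -
  have *: "Q x + c - adjoint A y - z - s = 0" "z + v = 0" "u - x = 0"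
    "s \<in> normal_cone nsd_cone (- x)" "v \<in> normal_cone P u"
    using assms(1) by (auto simp: multipliers_def)
  have "- s \<in> normal_cone psd_cone x"
    unfolding normal_cone_def
  proof safe
    fix Y :: "'a symmat" assume "Y \<in> psd_cone"
    then have "- Y \<in> nsd_cone"
      by (simp add: nsd_cone_def)
    then have "s \<bullet> (- Y - - x) \<le> 0"
      using *(4) unfolding normal_cone_def by blast
    then show "- s \<bullet> (Y - x) \<le> 0"
      by (simp add: inner_diff_right)
  qed (rule x)
  then show "s \<in> psd_cone" "s \<bullet> x = 0"
    using normal_cone_psd_cone_iff[OF x] by blast+
  have "- z = v" "u = x"
    using *(2,3) by (simp_all add: neg_eq_iff_add_eq_0)
  then show "- z \<in> normal_cone P x"
    using *(5) by simp
  show "Q x + c = adjoint A y + z + s"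
    using *(1) by (simp add: algebra_simps)
qed

theorem proposition5p3:
  fixes Q :: "('p::finite) symmat \<Rightarrow> 'p symmat"
    and A :: "'p symmat \<Rightarrow> real^'m"
    and c :: "'p symmat" and b :: "real^'m"
    and P W :: "'p symmat set"
    and x u :: "'p symmat"
  assumes "linear Q"
    and "\<And>X Y. Q X \<bullet> Y = X \<bullet> Q Y"
    and "\<And>X. 0 \<le> X \<bullet> Q X"
    and "linear A"
    and "polyhedron P" and "P \<noteq> {}"
    and "primal_optimal Q c A b P x u"
    and "multipliers Q c A b P x u \<noteq> {}"
    and "subspace W" and "range Q \<subseteq> W"
  shows "primal_SOSC Q c A b P x u \<longleftrightarrow> dual_extended_SRCQ Q c A b P W x u"
proof -
  note Q = assms(1-3) and A = assms(4)
  define \<Lambda> where "\<Lambda> = multipliers Q c A b P x u"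
  have x: "x \<in> psd_cone" "x \<in> P" "u = x"
    using assms(7) by (auto simp: primal_optimal_def primal_feasible_def)
  note \<Lambda> = multipliersD[OF _ x(1), of _ _ _ _ Q c A b P u, folded \<Lambda>_def]
  have adj: "e \<bullet> adjoint A y = A e \<bullet> y" for e y
    by (rule adjoint_works[OF A])
  have P: "convex P"
    using assms(5) by (rule polyhedron_imp_convex)
  have Q0: "Q e = 0" if "e \<bullet> Q e = 0" for e
    using semidefinite_form_null[OF Q(1,2) subspace_UNIV Q(3) UNIV_I that UNIV_I, of "Q e"]
    by simp
  \<comment> \<open>The directions that obstruct either condition.\<close>
  define obstructing where "obstructing e \<longleftrightarrow> A e = 0 \<and> Q e = 0 \<and>
    e \<in> tangent_cone psd_cone x \<and> e \<in> tangent_cone P x \<and>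
    (\<forall>(s, y, z, v)\<in>\<Lambda>. z \<bullet> e = 0 \<and> (\<forall>w. mat_of e *v (mat_of s *v w) = 0))" for e
  obtain s0 y0 z0 v0 where 0: "(s0, y0, z0, v0) \<in> \<Lambda>"
    using assms(8) by (auto simp: \<Lambda>_def)

  have "primal_SOSC Q c A b P x u \<longleftrightarrow> (\<forall>e. obstructing e \<longrightarrow> e = 0)"
  proof
    assume SOSC: "primal_SOSC Q c A b P x u"
    show "\<forall>e. obstructing e \<longrightarrow> e = 0"
    proof (intro allI impI, rule ccontr)
      fix e assume e: "obstructing e" "e \<noteq> 0"
      have zero: "s \<bullet> e = 0 \<and> sigma_term s x e = 0" if "(s, y, z, v) \<in> \<Lambda>" for s y z v
        using that e(1) sigma_term_zero_iff[OF \<Lambda>(1)[OF that] x(1) \<Lambda>(2)[OF that], of e]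
        by (auto simp: obstructing_def)
      \<comment> \<open>The gradient is \<open>adjoint A y + z + s\<close>, and \<open>e\<close> is orthogonal to each of its parts.\<close>
      have "(Q x + c) \<bullet> e = 0"
        using 0 e(1) zero[OF 0] adj[of e y0] unfolding \<Lambda>(4)[OF 0]
        by (auto simp: obstructing_def inner_add_right inner_commute[of _ e])
      then have "(e, e) \<in> critical_cone Q c A P x u"
        using e(1) x(3) by (simp add: obstructing_def critical_cone_def)
      then have "0 < (SUP (s, y, z, v) \<in> \<Lambda>. ereal (Q e \<bullet> e + 2 * sigma_term s x e))"
        using SOSC e(2) unfolding primal_SOSC_def \<Lambda>_def by fastforce
      moreover have "(SUP (s, y, z, v) \<in> \<Lambda>. ereal (Q e \<bullet> e + 2 * sigma_term s x e)) \<le> 0"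
        using zero e(1) by (intro SUP_least) (auto simp: obstructing_def)
      ultimately show False
        by simp
    qed
  next
    assume none: "\<forall>e. obstructing e \<longrightarrow> e = 0"
    show "primal_SOSC Q c A b P x u"
      unfolding primal_SOSC_def
    proof (clarify, rule ccontr)
      fix d d' assume C: "(d, d') \<in> critical_cone Q c A P x u" and n0: "\<not> (d = 0 \<and> d' = 0)"
        and "\<not> 0 < (SUP (s, y, z, v) \<in> multipliers Q c A b P x u.
          ereal (Q d \<bullet> d + 2 * sigma_term s x d))"
      then have sup: "(SUP (s, y, z, v) \<in> \<Lambda>. ereal (Q d \<bullet> d + 2 * sigma_term s x d)) \<le> 0"
        by (simp add: \<Lambda>_def not_less)
      have le0: "Q d \<bullet> d + 2 * sigma_term s x d \<le> 0" if "(s, y, z, v) \<in> \<Lambda>" for s y z v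
        using order_trans[OF SUP_upper[OF that] sup] by simp
      have d: "d' = d" "A d = 0" "d \<in> tangent_cone psd_cone x" "d \<in> tangent_cone P x"
        "(Q x + c) \<bullet> d = 0"
        using C x(3) by (auto simp: critical_cone_def)
      have Qd: "0 \<le> Q d \<bullet> d"
        using Q(3)[of d] by (simp add: inner_commute)
      have "Q d = 0"
        using le0[OF 0] Qd sigma_term_nonneg[OF \<Lambda>(1)[OF 0] x(1), of d]
        by (intro Q0) (simp add: inner_commute)
      moreover have "z \<bullet> d = 0 \<and> (\<forall>w. mat_of d *v (mat_of s *v w) = 0)"
        if m: "(s, y, z, v) \<in> \<Lambda>" for s y z v
      proof -
        have "- s \<in> normal_cone psd_cone x"
          using normal_cone_psd_cone_iff[OF x(1)] \<Lambda>(1,2)[OF m] by blast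
        then have "0 \<le> s \<bullet> d"
          using tangent_cone_imp_normal_cone_le[OF d(3)] by fastforce
        moreover have "0 \<le> z \<bullet> d"
          using tangent_cone_imp_normal_cone_le[OF d(4) \<Lambda>(3)[OF m]] by simp
        \<comment> \<open>Criticality makes both nonnegative terms vanish, whatever the multiplier.\<close>
        moreover have "z \<bullet> d + s \<bullet> d = 0"
          using d(2,5) adj[of d y] unfolding \<Lambda>(4)[OF m]
          by (simp add: inner_add_right inner_commute[of _ d])
        ultimately have "z \<bullet> d = 0" "s \<bullet> d = 0"
          by linarith+
        moreover have "sigma_term s x d = 0"
          using le0[OF m] Qd sigma_term_nonneg[OF \<Lambda>(1)[OF m] x(1), of d] by linarith
        ultimately show ?thesis
          using sigma_term_zero_iff[OF \<Lambda>(1)[OF m] x(1) \<Lambda>(2)[OF m] d(3)] by blast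
      qed
      ultimately have "obstructing d"
        using d by (auto simp: obstructing_def)
      then show False
        using none n0 d(1) by blast
    qed
  qed
  also have "\<dots> \<longleftrightarrow> dual_extended_SRCQ Q c A b P W x u"
  proof -
    define U where "U = (\<Union>(s, y, z, v) \<in> \<Lambda>. (tangent_cone psd_cone s \<inter> {x}\<^sup>\<bottom>) + S_set P x z)"
    define D where "D = convex hull U + range (adjoint A) + uminus ` Q ` W"
    have "linear (\<lambda>w. - Q w)"
      using Q(1) by (rule linear_compose_neg)
    then have "convex (uminus ` Q ` W)"
      using convex_linear_image[OF _ subspace_imp_convex[OF assms(9)], of "\<lambda>w. - Q w"]
      by (simp add: image_image)
    moreover have "convex (range (adjoint A))"
      by (intro convex_linear_image adjoint_linear A convex_UNIV)
    ultimately have "convex D"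
      unfolding D_def by (intro convex_set_plus convex_convex_hull)
    have DI: "h + adjoint A y - Q w \<in> D" if "h \<in> convex hull U" "w \<in> W" for h y w
      using that unfolding D_def diff_conv_add_uminus by (intro set_plus_intro) auto
    have "(\<exists>\<beta>. \<forall>g\<in>D. \<beta> \<le> e \<bullet> g) \<longleftrightarrow> obstructing e" for e
    proof
      assume "\<exists>\<beta>. \<forall>g\<in>D. \<beta> \<le> e \<bullet> g"
      then obtain \<beta> where \<beta>: "\<And>g. g \<in> D \<Longrightarrow> \<beta> \<le> e \<bullet> g"
        by blast
      have "\<beta> \<le> e \<bullet> g" if "g \<in> U" for g
        using \<beta>[OF DI[of g 0 0]] hull_inc[OF that] subspace_0[OF assms(9)]
          linear_0[OF Q(1)] linear_0[OF adjoint_linear[OF A]] by simp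
      then have m: "\<beta> \<le> e \<bullet> g" if "(s, y, z, v) \<in> \<Lambda>"
        "g \<in> tangent_cone psd_cone s \<inter> {x}\<^sup>\<bottom> + S_set P x z" for s y z v g
        using that by (force simp: U_def)
      have m': "e \<in> tangent_cone psd_cone x \<and> e \<in> tangent_cone P x \<and> z \<bullet> e = 0 \<and>
          (\<forall>w. mat_of e *v (mat_of s *v w) = 0)" if \<lambda>: "(s, y, z, v) \<in> \<Lambda>" for s y z v
        using bounded_below_on_summand[OF \<Lambda>(1)[OF \<lambda>] x(1) \<Lambda>(2)[OF \<lambda>] P \<Lambda>(3)[OF \<lambda>] m[OF \<lambda>]]
        by blast
      have "0 \<in> S_set P x z0"
        using S_set_contains[OF \<Lambda>(3)[OF 0], of 0 0] x(2) by (simp add: normal_cone_def)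
      moreover have "0 \<in> tangent_cone psd_cone s0 \<inter> {x}\<^sup>\<bottom>"
        using \<Lambda>(1)[OF 0]
        by (simp add: tangent_cone_psd_cone_iff orthogonal_comp_def orthogonal_def)
      ultimately have "0 + 0 \<in> tangent_cone psd_cone s0 \<inter> {x}\<^sup>\<bottom> + S_set P x z0"
        by (intro set_plus_intro)
      then have "0 \<in> U"
        using 0 by (force simp: U_def)
      then have D0: "adjoint A y - Q w \<in> D" if "w \<in> W" for y w
        using DI[OF hull_inc that, of 0 y] by simp
      have "\<beta> \<le> t * - (A e \<bullet> A e)" for t
        using \<beta>[OF D0[of 0 "- t *\<^sub>R A e"]] subspace_0[OF assms(9)] linear_0[OF Q(1)]
        by (simp add: adj)
      then have "0 \<le> - (A e \<bullet> A e)"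
        by (rule nonneg_if_multiples_bounded_below)
      then have "A e = 0"
        by (metis inner_eq_zero_iff inner_ge_zero neg_0_le_iff_le order_antisym)
      \<comment> \<open>As \<open>W\<close> contains the range of \<open>Q\<close>, it contains \<open>Q e\<close> itself, and
        \<open>e \<bullet> Q (Q e)\<close> is the squared norm of \<open>Q e\<close>.\<close>
      have "\<beta> \<le> t * - (Q e \<bullet> Q e)" for t
      proof -
        have "Q e \<in> W"
          using assms(10) by blast
        then have "\<beta> \<le> e \<bullet> (adjoint A 0 - Q (t *\<^sub>R Q e))"
          by (intro \<beta> D0 subspace_scale[OF assms(9)])
        then show ?thesis
          by (simp add: adj inner_diff_right linear_scale[OF Q(1)] flip: Q(2))
      qed
      then have "0 \<le> - (Q e \<bullet> Q e)"
        by (rule nonneg_if_multiples_bounded_below)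
      then have "Q e = 0"
        by (metis inner_eq_zero_iff inner_ge_zero neg_0_le_iff_le order_antisym)
      then show "obstructing e"
        using \<open>A e = 0\<close> m' m'[OF 0] unfolding obstructing_def by blast
    next
      assume "obstructing e"
      then have e: "A e = 0" "Q e = 0" "e \<in> tangent_cone psd_cone x" "e \<in> tangent_cone P x"
        "\<And>s y z v w. (s, y, z, v) \<in> \<Lambda> \<Longrightarrow> z \<bullet> e = 0 \<and> mat_of e *v (mat_of s *v w) = 0"
        by (auto simp: obstructing_def)
      have "U \<subseteq> {g. 0 \<le> e \<bullet> g}"
      proof (clarsimp simp: U_def)
        fix s y z v g
        assume m: "(s, y, z, v) \<in> \<Lambda>"
          and "g \<in> tangent_cone psd_cone s \<inter> {x}\<^sup>\<bottom> + S_set P x z"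
        then obtain k w where g: "g = k + w" "k \<in> tangent_cone psd_cone s \<inter> {x}\<^sup>\<bottom>"
          "w \<in> S_set P x z"
          by (auto elim: set_plus_elim)
        have "0 \<le> e \<bullet> k"
          using e(5)[OF m] g(2)
          by (intro inner_nonneg_tangent_cone_perp[OF \<Lambda>(1)[OF m] x(1) \<Lambda>(2)[OF m] e(3)]) auto
        moreover have "0 \<le> w \<bullet> e"
          using e(5)[OF m] by (intro S_set_inner_nonneg[OF assms(5) \<Lambda>(3)[OF m] g(3) e(4)]) auto
        ultimately show "0 \<le> e \<bullet> g"
          by (simp add: g(1) inner_add_right inner_commute)
      qed
      then have hull: "convex hull U \<subseteq> {g. 0 \<le> e \<bullet> g}"
        by (rule hull_minimal) (use convex_halfspace_ge[of 0 e] in simp)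
      have "0 \<le> e \<bullet> g" if "g \<in> D" for g
      proof -
        obtain h y w where "h \<in> convex hull U" "g = h + adjoint A y + - Q w"
          using \<open>g \<in> D\<close> by (auto simp: D_def elim!: set_plus_elim)
        then show ?thesis
          using hull e(1,2) Q(2)[of e w] by (auto simp: inner_diff_right inner_add_right adj)
      qed
      then show "\<exists>\<beta>. \<forall>g\<in>D. \<beta> \<le> e \<bullet> g"
        by blast
    qed
    then have "D = UNIV \<longleftrightarrow> (\<forall>e. obstructing e \<longrightarrow> e = 0)"
      unfolding convex_eq_UNIV_iff_unbounded[OF \<open>convex D\<close>] by metis
    then show ?thesis
      by (simp add: dual_extended_SRCQ_def D_def U_def \<Lambda>_def)
  qed
  finally show ?thesis .
qed

end
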